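(* Let $m,n\geq 1$. For $1\leq r\leq n$ and $0\leq s\leq m-1$ let $\mathrm{Polyo}^{(r,s)}_{n,m}$ be the set of $P\in\mathrm{Polyo}_{n,m}$ whose area word contains exactly $r$ letters $1$ and $s$ letters $\overline{1}$, and let $$\mathsf{Nara}^{(r,s)}_{n,m}(q,t)=\sum_{P\in\mathrm{Polyo}^{(r,s)}_{n,m}}t^{\mathsf{area}(P)}q^{\mathsf{dinv}(P)}.$$ Then for $1\leq r\leq n-1$ and $0\leq s\leq m-1$, $$\mathsf{Nara}^{(r,s)}_{n,m}(q,t)=t^{m+n-1}q^{r}\sum_{h=1}^{n-r}\sum_{k=0}^{m-s-1}q^s{s+r-1\brack s}_q{s+h-1\brack h}_q\,\mathsf{Nara}^{(h,k)}_{n-r,m-s}(q,t),$$ while $$\mathsf{Nara}^{(n,s)}_{n,m}(q,t)=\begin{cases}(qt)^{m+n-1}{m+n-2\brack m-1}_q & \text{if } s=m-1,\\ 0 & \text{if } s<m-1,\end{cases}$$ and $\mathsf{Nara}^{(r,0)}_{n,1}(q,t)=0$ for $r<n$.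
   Context: $\mathrm{Polyo}_{a,b}$: pairs of lattice paths (upper and lower) from $(0,0)$ to $(a,b)$ with unit North/East steps meeting only at the endpoints, upper path starting North, lower path starting East. $\mathsf{area}(P)$ is the number of unit squares between the paths. Area word: for each East step of the lower path, draw from its East endpoint a line of slope $-1$ going Northwest until it meets the upper path; label the step with the number of squares crossed. Label each North step of the upper path with $\overline{k}$, $k$ = number of interior squares in the row immediately East of it not crossed by any such line. Read labels in increasing order of $x+y$ of the step's starting point, upper-path label first in ties. $\mathsf{dinv}(P)$: with the total order $\overline{0}<1<\overline{1}<2<\overline{2}<3<\cdots$, the number of pairs $i<j$ of positions in the area word $a_1\cdots a_{a+b}$ such that $a_j$ is the immediate successor of $a_i$. $q$-analogues: $[n]_q=1+q+\cdots+q^{n-1}$ for $n\ge1$, $[0]_q!=1$, $[n]_q!=\prod_{i=1}^n[i]_q$, ${n\brack k}_q=\frac{[n]_q!}{[k]_q![n-k]_q!}$ for $0\le k\le n$, and ${n\brack k}_q=0$ if $k>n$. *)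

theory Defs
  imports "HOL-Computational_Algebra.Polynomial"
begin

section \<open>Lattice paths and parallelogram polyominoes\<close>

datatype step = North | East

type_synonym path = "step list"

definition point :: "path \<Rightarrow> nat \<Rightarrow> nat \<times> nat" where
  "point p i = (count_list (take i p) East, count_list (take i p) North)"

(* Paths starting at the origin with unit North/East steps can only meet in lattice points or in
   whole steps, so the lattice points visited determine where two paths meet. *)
definition path_points :: "path \<Rightarrow> (nat \<times> nat) set" where
  "path_points p = {point p i |i. i \<le> length p}"

definition paths_to :: "nat \<Rightarrow> nat \<Rightarrow> path set" where
  "paths_to a b = {p. count_list p East = a \<and> count_list p North = b}"

(* A polyomino is a pair (upper path, lower path). *)
definition Polyo :: "nat \<Rightarrow> nat \<Rightarrow> (path \<times> path) set" where
  "Polyo a b = {(U, L). U \<in> paths_to a b \<and> L \<in> paths_to a b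
     \<and> U \<noteq> [] \<and> hd U = North \<and> L \<noteq> [] \<and> hd L = East
     \<and> path_points U \<inter> path_points L = {(0, 0), (a, b)}}"

definition step_from :: "path \<Rightarrow> step \<Rightarrow> nat \<times> nat \<Rightarrow> bool" where
  "step_from p d z \<longleftrightarrow> (\<exists>i < length p. p ! i = d \<and> point p i = z)"

(* A unit square is represented by its South-West corner.  The square (x, y) lies between the
   paths iff, in row y, it is to the right of the North step of the upper path and to the left of
   the North step of the lower path. *)
definition interior_squares :: "path \<times> path \<Rightarrow> (nat \<times> nat) set" where
  "interior_squares P = {(x, y). \<exists>u l. step_from (fst P) North (u, y) \<and>
     step_from (snd P) North (l, y) \<and> u \<le> x \<and> x < l}"

definition area :: "path \<times> path \<Rightarrow> nat" where
  "area P = card (interior_squares P)"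

section \<open>Area word and dinv\<close>

(* Plain k is the letter k, Bar k is the letter k with an overline. *)
datatype letter = Plain nat | Bar nat

(* Label of the East step of the lower path starting at (x, y).  The line of slope -1 going
   North-West from (x + 1, y) passes through the points (x + 1 - k, y + k), crossing one square
   between consecutive ones, and it can meet the upper path only in such a point. *)
definition east_label :: "path \<times> path \<Rightarrow> nat \<times> nat \<Rightarrow> nat" where
  "east_label P z = (LEAST k. \<exists>u. u + k = fst z + 1 \<and> (u, snd z + k) \<in> path_points (fst P))"

definition line_squares :: "path \<times> path \<Rightarrow> nat \<times> nat \<Rightarrow> (nat \<times> nat) set" where
  "line_squares P z = {(c, d). \<exists>j < east_label P z. c + j = fst z \<and> d = snd z + j}"

definition crossed_squares :: "path \<times> path \<Rightarrow> (nat \<times> nat) set" where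
  "crossed_squares P = \<Union> {line_squares P z |z. step_from (snd P) East z}"

definition north_label :: "path \<times> path \<Rightarrow> nat \<times> nat \<Rightarrow> nat" where
  "north_label P z = card {(x, y). (x, y) \<in> interior_squares P - crossed_squares P \<and> y = snd z}"

(* The i-th step of either path (counted from 0) starts on the antidiagonal x + y = i. *)
definition area_word :: "path \<times> path \<Rightarrow> letter list" where
  "area_word P = concat (map (\<lambda>i.
      (if fst P ! i = North then [Bar (north_label P (point (fst P) i))] else []) @
      (if snd P ! i = East then [Plain (east_label P (point (snd P) i))] else []))
    [0..<length (fst P)])"

(* Immediate successor in the total order
     Bar 0 < Plain 1 < Bar 1 < Plain 2 < Bar 2 < Plain 3 < ...
   Plain 0 does not belong to the alphabet and never occurs in the area word of a polyomino. *)
fun next_letter :: "letter \<Rightarrow> letter" where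
  "next_letter (Bar k) = Plain (Suc k)"
| "next_letter (Plain k) = Bar k"

definition dinv :: "path \<times> path \<Rightarrow> nat" where
  "dinv P = card {(i, j). i < j \<and> j < length (area_word P) \<and>
     area_word P ! j = next_letter (area_word P ! i)}"

section \<open>q-analogues\<close>

definition q_int :: "'a::comm_ring_1 \<Rightarrow> nat \<Rightarrow> 'a" where
  "q_int q n = (\<Sum>i<n. q ^ i)"

definition q_fact :: "'a::comm_ring_1 \<Rightarrow> nat \<Rightarrow> 'a" where
  "q_fact q n = (\<Prod>i=1..n. q_int q i)"

(* Used only for an indeterminate q of a polynomial ring, where the division is exact. *)
definition q_binom :: "'a::idom_divide \<Rightarrow> nat \<Rightarrow> nat \<Rightarrow> 'a" where
  "q_binom q n k = (if k \<le> n then q_fact q n div (q_fact q k * q_fact q (n - k)) else 0)"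

section \<open>The refined q,t-Narayana polynomials\<close>

(* Z[q,t] is represented as Z[q][t]. *)
definition q_var :: "int poly poly" where
  "q_var = [:[:0, 1:]:]"

definition t_var :: "int poly poly" where
  "t_var = [:0, 1:]"

definition Polyo_rs :: "nat \<Rightarrow> nat \<Rightarrow> nat \<Rightarrow> nat \<Rightarrow> (path \<times> path) set" where
  "Polyo_rs r s n m = {P \<in> Polyo n m.
     count_list (area_word P) (Plain 1) = r \<and> count_list (area_word P) (Bar 1) = s}"

definition Nara :: "nat \<Rightarrow> nat \<Rightarrow> nat \<Rightarrow> nat \<Rightarrow> int poly poly" where
  "Nara r s n m = (\<Sum>P \<in> Polyo_rs r s n m. t_var ^ area P * q_var ^ dinv P)"

lemma finite_paths_to: "finite (paths_to a b)"
proof (rule finite_subset)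
  have "length p = count_list p East + count_list p North" for p
  proof (induction p)
    case (Cons d p)
    then show ?case by (cases d) auto
  qed simp
  then show "paths_to a b \<subseteq> {p. set p \<subseteq> {North, East} \<and> length p = a + b}"
    using step.exhaust by (auto simp: paths_to_def)
  show "finite {p. set p \<subseteq> {North, East} \<and> length p = a + b}"
    by (rule finite_lists_length_eq) simp
qed

lemma finite_Polyo: "finite (Polyo a b)"
  by (rule finite_subset[of _ "paths_to a b \<times> paths_to a b"])
    (auto simp: Polyo_def finite_paths_to)

end

theory Submission
  imports Defs
begin

text \<open>
  Ranking the letters \<open>Bar k\<close>, \<open>Plain k\<close> as \<open>2 * k\<close>, \<open>2 * k - 1\<close> turns area words into the words
  \<open>0 # v\<close> in which all letters of \<open>v\<close> are positive and every letter exceeds its predecessor by at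
  most one; area and dinv are read off the word, and the polyomino is recovered from it by following
  the distance of the two paths along the antidiagonals.  Such a word \<open>v\<close> is determined by three
  pieces, independent up to matching letter counts: its subword on the letters \<open>1, 2\<close>, its subword on the letters \<open>2, 3\<close>, and
  the word of the letters \<open>\<ge> 3\<close> lowered by \<open>2\<close>, which is again of the same kind.
  The first two contribute the \<open>q\<close>-binomial coefficients (the first letter of each is forced), the
  last one the smaller Narayana polynomial.
\<close>

section \<open>q-binomial coefficients and two-letter words\<close>

text \<open>This is dinv on words of ranks; \<open>card_succ_pairs\<close> and
  \<open>dinv_eq\<close> make the link.\<close>

fun succ_pairs :: "nat list \<Rightarrow> nat" where
  "succ_pairs [] = 0"
| "succ_pairs (x # v) = count_list v (Suc x) + succ_pairs v"

text \<open>The lower letter \<open>x\<close> is left general because both the letters 1, 2 and the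
  letters 2, 3 occur below.\<close>

definition two_letter_words :: "nat \<Rightarrow> nat \<Rightarrow> nat \<Rightarrow> nat list set" where
  "two_letter_words x r s =
     {a. set a \<subseteq> {x, Suc x} \<and> count_list a x = r \<and> count_list a (Suc x) = s}"

lemma two_letter_words_0_left: "two_letter_words x 0 s = {replicate s (Suc x)}"
proof -
  have "a = replicate (count_list a (Suc x)) (Suc x)"
    if "set a \<subseteq> {x, Suc x}" "count_list a x = 0" for a
    using that by (induction a) (auto split: if_splits)
  moreover have "count_list (replicate s (Suc x)) (Suc x) = s"
    "count_list (replicate s (Suc x)) x = 0" for s
    by (induction s) auto
  ultimately show ?thesis
    by (auto simp: two_letter_words_def)
qed

lemma two_letter_words_0_right: "two_letter_words x r 0 = {replicate r x}"
proof -
  have "a = replicate (count_list a x) x"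
    if "set a \<subseteq> {x, Suc x}" "count_list a (Suc x) = 0" for a
    using that by (induction a) (auto split: if_splits)
  moreover have "count_list (replicate r x) x = r"
    "count_list (replicate r x) (Suc x) = 0" for r
    by (induction r) auto
  ultimately show ?thesis
    by (auto simp: two_letter_words_def)
qed

lemma two_letter_words_Suc_Suc:
  "two_letter_words x (Suc r) (Suc s) =
     Cons x ` two_letter_words x r (Suc s) \<union> Cons (Suc x) ` two_letter_words x (Suc r) s"
proof -
  have "a \<in> two_letter_words x (Suc r) (Suc s) \<longleftrightarrow>
      a \<in> Cons x ` two_letter_words x r (Suc s) \<union> Cons (Suc x) ` two_letter_words x (Suc r) s" for a
    by (cases a) (auto simp: two_letter_words_def)
  then show ?thesis
    by blast
qed

lemma finite_two_letter_words: "finite (two_letter_words x r s)"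
proof (induction "r + s" arbitrary: r s rule: less_induct)
  case less
  then show ?case
    by (cases r; cases s)
      (simp_all add: two_letter_words_0_left two_letter_words_0_right two_letter_words_Suc_Suc)
qed

lemma succ_pairs_Cons_fst:
  "a \<in> two_letter_words x r s \<Longrightarrow> succ_pairs (x # a) = s + succ_pairs a"
  by (simp add: two_letter_words_def)

lemma succ_pairs_Cons_snd:
  "a \<in> two_letter_words x r s \<Longrightarrow> succ_pairs (Suc x # a) = succ_pairs a"
  by (auto simp: two_letter_words_def count_list_0_iff)

definition two_letter_gf :: "'a::comm_ring_1 \<Rightarrow> nat \<Rightarrow> nat \<Rightarrow> nat \<Rightarrow> 'a" where
  "two_letter_gf q x r s = (\<Sum>a\<in>two_letter_words x r s. q ^ succ_pairs a)"

lemma succ_pairs_replicate: "succ_pairs (replicate k x) = 0"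
proof -
  have "count_list (replicate k x) (Suc x) = 0" for k
    by (induction k) auto
  then show ?thesis
    by (induction k) auto
qed

text \<open>The q-Pascal rule, by the first letter: a leading \<open>x\<close> forms a pair with
  each of the \<open>Suc s\<close> larger letters, a leading \<open>Suc x\<close> with none.\<close>

lemma two_letter_gf_Suc_Suc:
  "two_letter_gf q x (Suc r) (Suc s) =
     q ^ Suc s * two_letter_gf q x r (Suc s) + two_letter_gf q x (Suc r) s"
proof -
  have "two_letter_gf q x (Suc r) (Suc s) =
      (\<Sum>a\<in>two_letter_words x r (Suc s). q ^ succ_pairs (x # a))
      + (\<Sum>a\<in>two_letter_words x (Suc r) s. q ^ succ_pairs (Suc x # a))"
    unfolding two_letter_gf_def two_letter_words_Suc_Suc
    by (subst sum.union_disjoint)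
      (auto simp: finite_two_letter_words sum.reindex inj_on_def simp del: succ_pairs.simps)
  also have "(\<Sum>a\<in>two_letter_words x r (Suc s). q ^ succ_pairs (x # a))
      = (\<Sum>a\<in>two_letter_words x r (Suc s). q ^ Suc s * q ^ succ_pairs a)"
    by (rule sum.cong) (simp_all only: succ_pairs_Cons_fst power_add)
  also have "(\<Sum>a\<in>two_letter_words x (Suc r) s. q ^ succ_pairs (Suc x # a))
      = (\<Sum>a\<in>two_letter_words x (Suc r) s. q ^ succ_pairs a)"
    by (rule sum.cong) (simp_all add: succ_pairs_Cons_snd del: succ_pairs.simps)
  finally show ?thesis
    by (simp add: two_letter_gf_def sum_distrib_left)
qed

lemma q_int_add: "q_int q (k + l) = q_int q k + q ^ k * q_int q l"
  by (induction l) (simp_all add: q_int_def algebra_simps power_add)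

lemma q_fact_Suc: "q_fact q (Suc n) = q_fact q n * q_int q (Suc n)"
  by (simp add: q_fact_def mult.commute)

lemma q_fact_0: "q_fact q 0 = 1"
  by (simp add: q_fact_def)

text \<open>Multiplying out the q-factorials avoids division, so the q-Pascal rule can be used in
  any commutative ring. The induction step rests on [s] + q^s [r] = [r + s].\<close>

lemma two_letter_gf_mult_q_fact:
  "two_letter_gf q x r s * (q_fact q r * q_fact q s) = q_fact q (r + s)"
proof (induction "r + s" arbitrary: r s)
  case 0
  then show ?case
    by (simp add: two_letter_gf_def two_letter_words_0_left q_fact_0)
next
  case (Suc k)
  consider "r = 0" | "s = 0" | r' s' where "r = Suc r'" "s = Suc s'"
    by (meson not0_implies_Suc)
  then show ?case
  proof cases
    case 3
    have IH1: "two_letter_gf q x r' s * (q_fact q r' * q_fact q s) = q_fact q k"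
      and IH2: "two_letter_gf q x r s' * (q_fact q r * q_fact q s') = q_fact q k"
      using Suc.hyps(1)[of r' s] Suc.hyps(1)[of r s'] Suc.hyps(2) 3 by simp_all
    have fr: "q_fact q r = q_fact q r' * q_int q r" and fs: "q_fact q s = q_fact q s' * q_int q s"
      by (simp_all only: 3 q_fact_Suc)
    have first: "q ^ s * two_letter_gf q x r' s * (q_fact q r * q_fact q s)
        = q ^ s * q_int q r * (two_letter_gf q x r' s * (q_fact q r' * q_fact q s))"
      unfolding fr by (simp only: mult_ac)
    have second: "two_letter_gf q x r s' * (q_fact q r * q_fact q s)
        = q_int q s * (two_letter_gf q x r s' * (q_fact q r * q_fact q s'))"
      unfolding fs by (simp only: mult_ac)
    have "two_letter_gf q x r s * (q_fact q r * q_fact q s)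
        = q ^ s * q_int q r * (two_letter_gf q x r' s * (q_fact q r' * q_fact q s))
          + q_int q s * (two_letter_gf q x r s' * (q_fact q r * q_fact q s'))"
      using two_letter_gf_Suc_Suc[of q x r' s'] unfolding 3[symmetric]
      by (simp only: distrib_right first second)
    also have "\<dots> = q_fact q k * q_int q (s + r)"
      unfolding IH1 IH2 q_int_add by (simp add: algebra_simps)
    also have "\<dots> = q_fact q (r + s)"
      using Suc.hyps(2) q_fact_Suc[of q k] by (simp add: add.commute)
    finally show ?thesis .
  qed (simp_all add: two_letter_gf_def two_letter_words_0_left two_letter_words_0_right q_fact_0
      succ_pairs_replicate)
qed

lemma q_int_q_var_nonzero: "0 < n \<Longrightarrow> q_int q_var n \<noteq> 0"
proof
  assume "0 < n" "q_int q_var n = 0"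
  \<comment> \<open>Setting t = 0 and then q = 1 turns each power of q into 1.\<close>
  moreover have "poly (poly (q_int q_var n) 0) 1 = int n"
    by (simp add: q_int_def q_var_def poly_sum poly_power)
  ultimately show False
    by simp
qed

lemma q_fact_q_var_nonzero: "q_fact q_var n \<noteq> 0"
  by (induction n) (simp_all add: q_fact_0 q_fact_Suc q_int_q_var_nonzero)

lemma two_letter_gf_q_var: "two_letter_gf q_var x r s = q_binom q_var (r + s) s"
proof -
  have "q_fact q_var (r + s) =
      two_letter_gf q_var x r s * (q_fact q_var s * q_fact q_var r)"
    using two_letter_gf_mult_q_fact[of q_var x r s] by (simp add: mult.commute)
  then show ?thesis
    by (simp add: q_binom_def q_fact_q_var_nonzero)
qed

section \<open>Two-letter words with a forced first letter\<close>

definition headed_words :: "nat \<Rightarrow> nat \<Rightarrow> nat \<Rightarrow> nat list set" where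
  "headed_words x r s = {a \<in> two_letter_words x r s. a = [] \<or> hd a = x}"

lemma finite_headed_words: "finite (headed_words x r s)"
  by (simp add: headed_words_def finite_two_letter_words)

text \<open>The forced letter \<open>x\<close> forms a pair with each of the \<open>s\<close> larger
  letters, and what follows it is an arbitrary two-letter word with one \<open>x\<close>
  less.\<close>

lemma headed_words_gf:
  assumes "0 < r + s"
  shows "(\<Sum>a\<in>headed_words x r s. q_var ^ succ_pairs a)
    = q_var ^ s * q_binom q_var (r + s - 1) s"
proof (cases r)
  \<comment> \<open>Without the letter \<open>x\<close> no nonempty word is headed by it; the
    binomial vanishes since its lower index exceeds the upper one.\<close>
  case 0
  then have "headed_words x r s = {}"
    using assms by (cases s) (auto simp: headed_words_def two_letter_words_0_left)
  then show ?thesis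
    using 0 assms by (simp add: q_binom_def)
next
  case (Suc r')
  have "a \<in> headed_words x r s \<longleftrightarrow> a \<in> Cons x ` two_letter_words x r' s" for a
    by (cases a) (auto simp: Suc headed_words_def two_letter_words_def)
  then have "headed_words x r s = Cons x ` two_letter_words x r' s"
    by blast
  then have "(\<Sum>a\<in>headed_words x r s. q_var ^ succ_pairs a)
      = (\<Sum>a\<in>two_letter_words x r' s. q_var ^ succ_pairs (x # a))"
    by (simp add: sum.reindex del: succ_pairs.simps)
  also have "\<dots> = (\<Sum>a\<in>two_letter_words x r' s. q_var ^ s * q_var ^ succ_pairs a)"
    by (rule sum.cong) (simp_all add: succ_pairs_Cons_fst power_add del: succ_pairs.simps)
  also have "\<dots> = q_var ^ s * two_letter_gf q_var x r' s"
    by (simp add: two_letter_gf_def sum_distrib_left)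
  finally show ?thesis
    by (simp add: Suc two_letter_gf_q_var)
qed

section \<open>Splitting words by letter size\<close>

text \<open>The parameter \<open>b\<close> is the bound that the preceding letter puts on the next
  one, so inductions can pass to a suffix.\<close>

fun capped :: "nat \<Rightarrow> nat list \<Rightarrow> bool" where
  "capped b [] \<longleftrightarrow> True"
| "capped b (x # v) \<longleftrightarrow> 1 \<le> x \<and> x \<le> b \<and> capped (Suc x) v"

lemma capped_mono: "capped b v \<Longrightarrow> b \<le> c \<Longrightarrow> capped c v"
  by (cases v) auto

text \<open>The ranks \<open>2 * k - 1\<close> and \<open>2 * k\<close> of \<open>Plain k\<close>
  and \<open>Bar k\<close> both contribute \<open>k\<close>, so this is the sum of the labels, which
  \<open>area_eq\<close> identifies with the area.\<close>

definition half_sum :: "nat list \<Rightarrow> nat" where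
  "half_sum v = (\<Sum>x\<leftarrow>v. (x + 1) div 2)"

definition lo :: "nat list \<Rightarrow> nat list" where
  "lo v = filter (\<lambda>x. x \<le> 2) v"

definition mid :: "nat list \<Rightarrow> nat list" where
  "mid v = filter (\<lambda>x. x = 2 \<or> x = 3) v"

text \<open>Lowering by 2 preserves parity, hence the distinction between plain and barred
  letters.\<close>

definition hi :: "nat list \<Rightarrow> nat list" where
  "hi v = map (\<lambda>x. x - 2) (filter (\<lambda>x. 3 \<le> x) v)"

lemma split_simps:
  "lo [] = []" "mid [] = []" "hi [] = []"
  "lo (x # v) = (if x \<le> 2 then x # lo v else lo v)"
  "mid (x # v) = (if x = 2 \<or> x = 3 then x # mid v else mid v)"
  "hi (x # v) = (if 3 \<le> x then (x - 2) # hi v else hi v)"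
  by (simp_all add: lo_def mid_def hi_def)

lemma count_list_hi: "count_list (hi v) (Suc x) = count_list v (x + 3)"
  by (induction v) (auto simp: split_simps)

lemma count_list_lo: "x \<le> 2 \<Longrightarrow> count_list (lo v) x = count_list v x"
  by (induction v) (auto simp: split_simps)

lemma count_list_mid: "x = 2 \<or> x = 3 \<Longrightarrow> count_list (mid v) x = count_list v x"
  by (induction v) (auto simp: split_simps)

lemma set_lo: "capped b v \<Longrightarrow> set (lo v) \<subseteq> {1, 2}"
  by (induction b v rule: capped.induct) (auto simp: split_simps)

lemma set_mid: "set (mid v) \<subseteq> {2, 3}"
  by (auto simp: mid_def)

text \<open>Two successive values are 1, 2 or 2, 3 or both at least 3, so each pair is counted in
  exactly one of the three subwords.\<close>

lemma succ_pairs_split: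
  assumes "capped b v"
  shows "succ_pairs v = succ_pairs (lo v) + succ_pairs (mid v) + succ_pairs (hi v)"
  using assms
proof (induction b v rule: capped.induct)
  case (2 b x v)
  have "count_list (lo v) 3 = 0" "count_list (mid v) 4 = 0"
    by (auto simp: count_list_0_iff lo_def mid_def)
  moreover have "1 \<le> x"
    using 2 by simp
  then have "x = 1 \<or> x = 2 \<or> x = 3 \<or> (\<exists>y. x = y + 4)"
    by presburger
  ultimately show ?case
    using 2 count_list_hi[of v 1] count_list_lo[of 2 v] count_list_mid[of 3 v]
      count_list_hi[of v "x - 2"]
    by (auto simp: split_simps numeral_eq_Suc)
qed (simp add: split_simps)

text \<open>The letters 1 and 2 contribute 1 each, and lowering a larger letter by 2 reduces its
  contribution by 1; either way one unit per letter is split off.\<close>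

lemma half_sum_split:
  "capped b v \<Longrightarrow> half_sum v = length v + half_sum (hi v)"
proof (induction b v rule: capped.induct)
  case (2 b x v)
  then have "1 \<le> x"
    by simp
  then have "x = 1 \<or> x = 2 \<or> (\<exists>y. x = y + 3)"
    by presburger
  then show ?case
    using 2 by (auto simp: split_simps half_sum_def)
qed (simp add: split_simps half_sum_def)

lemma odd_hi: "capped b v \<Longrightarrow>
  length (filter odd v) = count_list v 1 + length (filter odd (hi v))"
proof (induction b v rule: capped.induct)
  case (2 b x v)
  then have "1 \<le> x"
    by simp
  then have "x = 1 \<or> x = 2 \<or> (\<exists>y. x = y + 3)"
    by presburger
  then show ?case
    using 2 by (auto simp: split_simps)
qed (simp add: split_simps)

lemma even_hi: "capped b v \<Longrightarrow>
  length (filter even v) = count_list v 2 + length (filter even (hi v))"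
proof (induction b v rule: capped.induct)
  case (2 b x v)
  then have "1 \<le> x"
    by simp
  then have "x = 1 \<or> x = 2 \<or> (\<exists>y. x = y + 3)"
    by presburger
  then show ?case
    using 2 by (auto simp: split_simps)
qed (simp add: split_simps)

text \<open>After a letter at most 2 the next large letter can only be a 3, which is lowered to 1;
  this is why the cap does not fall below 1.\<close>

lemma capped_hi: "capped b v \<Longrightarrow> capped (max 1 (b - 2)) (hi v)"
proof (induction b v rule: capped.induct)
  case (2 b x v)
  then show ?case
    using capped_mono[of "max 1 (Suc x - 2)" "hi v" "max 1 (b - 2)"]
      capped_mono[of "max 1 (Suc x - 2)" "hi v" "Suc (x - 2)"]
    by (auto simp: split_simps)
qed (simp add: split_simps)

section \<open>Reconstruction of a word from its three subwords\<close>

text \<open>A word that may start with at most 2 reaches its first 3 only through a 2.\<close>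

lemma hd_mid: "capped b v \<Longrightarrow> b \<le> 2 \<Longrightarrow> mid v = [] \<or> hd (mid v) = 2"
proof (induction b v rule: capped.induct)
  case (2 b x v)
  then show ?case
    by (cases "x = 1") (auto simp: split_simps)
qed (simp add: split_simps)

lemma hd_lo: "capped 1 v \<Longrightarrow> lo v = [] \<or> hd (lo v) = 1"
  by (cases v) (auto simp: split_simps)

text \<open>Large letters can only be entered from a \<open>2\<close> through a \<open>3\<close>, hence a run of
  large letters directly follows a \<open>2\<close>; this determines the first letter.\<close>

lemma first_letter_of_split:
  assumes "capped b (x # v)"
  shows "x = (if hi (x # v) \<noteq> [] \<and> 2 \<le> hd (hi (x # v)) then hd (hi (x # v)) + 2
              else if mid (x # v) \<noteq> [] \<and> hd (mid (x # v)) = 3 then 3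
              else hd (lo (x # v)))"
proof -
  have v: "1 \<le> x" "capped (Suc x) v"
    using assms by auto
  \<comment> \<open>Thus a head of \<open>hi\<close> that is at least 2 can only come from a first
    letter that is at least 4.\<close>
  have hi: "hi v = [] \<or> hd (hi v) = 1" if "x \<le> 2"
    using capped_hi[OF v(2)] that v(1) by (cases "hi v") auto
  consider "x = 1" | "x = 2" | "3 \<le> x"
    using v by linarith
  then show ?thesis
  proof cases
    case 1
    then show ?thesis
      using hi hd_mid[OF v(2)] by (auto simp: split_simps)
  qed (use hi in \<open>auto simp: split_simps\<close>)
qed

text \<open>By \<open>first_letter_of_split\<close> the three subwords determine the first letter;
  deleting it from the subwords containing it leaves the subwords of the rest.\<close>

lemma split_inj:
  assumes "capped b v" "capped b w" "lo v = lo w" "mid v = mid w" "hi v = hi w"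
  shows "v = w"
  using assms
proof (induction v arbitrary: b w)
  case Nil
  then show ?case
    by (cases w) (auto simp: split_simps split: if_splits)
next
  case (Cons x v)
  then obtain y w' where w: "w = y # w'"
    by (cases w) (auto simp: split_simps split: if_splits)
  have "x = y"
    using first_letter_of_split[OF Cons.prems(1), unfolded Cons.prems(3-5) w]
      first_letter_of_split[OF Cons.prems(2)[unfolded w]]
    by (rule trans[OF _ sym])
  then have "lo v = lo w'" "mid v = mid w'" "hi v = hi w'"
    using Cons.prems by (auto simp: w split_simps split: if_splits)
  then have "v = w'"
    using Cons.IH[of "Suc x" w'] Cons.prems \<open>x = y\<close> by (simp add: w)
  then show ?case
    by (simp add: w \<open>x = y\<close>)
qed

text \<open>The word is built greedily by the rule of \<open>first_letter_of_split\<close>. The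
  count conditions ensure that a letter 2 or 3 chosen from one subword also heads the other subword
  sharing it.\<close>

lemma split_surj:
  assumes "set a \<subseteq> {1, 2}" "set m \<subseteq> {2, 3}"
    and "count_list m 2 = count_list a 2" "count_list m 3 = count_list c 1"
    and "capped (max 1 (b - 2)) c" "1 \<le> b"
    and "b \<le> 2 \<Longrightarrow> m = [] \<or> hd m = 2" "b \<le> 1 \<Longrightarrow> a = [] \<or> hd a = 1"
  shows "\<exists>v. capped b v \<and> lo v = a \<and> mid v = m \<and> hi v = c"
  using assms
proof (induction "length a + length m + length c" arbitrary: a m c b rule: less_induct)
  case less
  note prems = less.prems
  \<comment> \<open>The cases are: first letter at least 4, equal to 3, to 1, to 2, and the empty
    word.\<close>
  consider x c' where "c = x # c'" "2 \<le> x"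
    | m' where "c = [] \<or> hd c = 1" "m = 3 # m'"
    | a' where "c = [] \<or> hd c = 1" "m = [] \<or> hd m = 2" "a = 1 # a'"
    | a' where "c = [] \<or> hd c = 1" "m = [] \<or> hd m = 2" "a = 2 # a'"
    | "c = [] \<or> hd c = 1" "m = [] \<or> hd m = 2" "a = []"
    using prems(1,2,5)
    by (cases a; cases m; cases c) (auto, force+)
  then show ?case
  proof cases
    case 1
    have "\<exists>v. capped (x + 3) v \<and> lo v = a \<and> mid v = m \<and> hi v = c'"
      using prems 1 by (intro less.hyps) auto
    then obtain v where "capped (x + 3) v" "lo v = a" "mid v = m" "hi v = c'"
      by blast
    then show ?thesis
      using 1 prems by (intro exI[of _ "(x + 2) # v"]) (auto simp: split_simps numeral_eq_Suc)
  next
    case 2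
    \<comment> \<open>The 3 heading \<open>m\<close> needs a matching 1 in \<open>c\<close>, which
      must then be the head of \<open>c\<close>.\<close>
    then have "count_list c 1 \<noteq> 0"
      using prems by auto
    then obtain c' where c: "c = 1 # c'"
      using 2 by (cases c) auto
    have "3 \<le> b"
      using prems(7) 2 by force
    have "\<exists>v. capped 4 v \<and> lo v = a \<and> mid v = m' \<and> hi v = c'"
      using prems 2 c by (intro less.hyps) (auto simp: numeral_eq_Suc)
    then obtain v where "capped 4 v" "lo v = a" "mid v = m'" "hi v = c'"
      by blast
    then show ?thesis
      using 2 c \<open>3 \<le> b\<close> by (intro exI[of _ "3 # v"]) (auto simp: split_simps numeral_eq_Suc)
  next
    case 3
    have "capped 1 c"
      using 3(1) prems(5) by (cases c) auto
    have "\<exists>v. capped 2 v \<and> lo v = a' \<and> mid v = m \<and> hi v = c"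
      using prems 3 \<open>capped 1 c\<close> by (intro less.hyps) auto
    then obtain v where "capped 2 v" "lo v = a'" "mid v = m" "hi v = c"
      by blast
    then show ?thesis
      using 3 prems by (intro exI[of _ "1 # v"]) (auto simp: split_simps numeral_eq_Suc)
  next
    case 4
    have "capped 1 c"
      using 4(1) prems(5) by (cases c) auto
    \<comment> \<open>The 2 heading \<open>a\<close> needs a matching 2 in \<open>m\<close>, so
      \<open>m\<close> is nonempty and begins with 2.\<close>
    have "count_list m 2 \<noteq> 0"
      using prems(3) 4 by simp
    then obtain m' where m: "m = 2 # m'"
      using 4 by (cases m) auto
    have "2 \<le> b"
      using prems(8) 4 by force
    have "\<exists>v. capped 3 v \<and> lo v = a' \<and> mid v = m' \<and> hi v = c"
      using prems 4 m \<open>capped 1 c\<close> by (intro less.hyps) auto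
    then obtain v where "capped 3 v" "lo v = a'" "mid v = m'" "hi v = c"
      by blast
    then show ?thesis
      using 4 m \<open>2 \<le> b\<close> by (intro exI[of _ "2 # v"]) (auto simp: split_simps numeral_eq_Suc)
  next
    case 5
    \<comment> \<open>Emptiness propagates: no 2 in \<open>a\<close> means none in \<open>m\<close>,
      so \<open>m\<close> cannot begin with 2; no 3 in \<open>m\<close> means no 1 in
      \<open>c\<close>, so \<open>c\<close> cannot begin with 1.\<close>
    then have "m = []"
      using prems(3) by (cases m) auto
    then have "c = []"
      using prems(4) 5 by (cases c) auto
    then show ?thesis
      using 5 \<open>m = []\<close> by (intro exI[of _ "[]"]) (auto simp: split_simps)
  qed
qed

section \<open>The recursion for words\<close>

text \<open>Odd letters stand for East steps of the lower path, even ones for North steps of the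
  upper path. The leading 0 is left out, so \<open>Polyo n m\<close> corresponds to
  \<open>words n (m - 1)\<close>.\<close>

definition words :: "nat \<Rightarrow> nat \<Rightarrow> nat list set" where
  "words n k = {v. capped 1 v \<and> length (filter odd v) = n \<and> length (filter even v) = k}"

definition words_rs :: "nat \<Rightarrow> nat \<Rightarrow> nat \<Rightarrow> nat \<Rightarrow> nat list set" where
  "words_rs r s n k = {v \<in> words n k. count_list v 1 = r \<and> count_list v 2 = s}"

text \<open>The summand \<open>count_list v 1\<close> counts the pairs formed with the omitted
  leading 0.\<close>

definition word_weight :: "nat list \<Rightarrow> int poly poly" where
  "word_weight v = t_var ^ half_sum v * q_var ^ (count_list v 1 + succ_pairs v)"

definition word_gf :: "nat \<Rightarrow> nat \<Rightarrow> nat \<Rightarrow> nat \<Rightarrow> int poly poly" where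
  "word_gf r s n k = (\<Sum>v\<in>words_rs r s n k. word_weight v)"

lemma length_odd_even: "length v = length (filter odd v) + length (filter even v)"
  using sum_length_filter_compl[of odd v] by simp

lemma capped_bound: "capped b v \<Longrightarrow> set v \<subseteq> {..<b + length v}"
proof (induction b v rule: capped.induct)
  case (2 b x v)
  then have "set v \<subseteq> {..<b + length (x # v)}"
    by (intro subset_trans[OF "2.IH"]) auto
  then show ?case
    using 2 by simp
qed simp

lemma finite_words: "finite (words n k)"
proof (rule finite_subset)
  show "words n k \<subseteq> {v. set v \<subseteq> {..<1 + (n + k)} \<and> length v = n + k}"
  proof
    fix v
    assume "v \<in> words n k"
    then show "v \<in> {v. set v \<subseteq> {..<1 + (n + k)} \<and> length v = n + k}"
      using capped_bound[of 1 v] length_odd_even[of v] by (simp add: words_def)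
  qed
qed (simp add: finite_lists_length_eq)

text \<open>The number of 2s links \<open>lo\<close> and \<open>mid\<close>; the 3s of
  \<open>mid\<close> are the 1s of \<open>hi\<close>. Only the second link involves the variable
  part \<open>c\<close>, hence the dependent sum.\<close>

lemma split_bij_betw:
  assumes "r \<le> n" "s \<le> k"
  shows "bij_betw (\<lambda>v. (hi v, lo v, mid v)) (words_rs r s n k)
    (SIGMA c:words (n - r) (k - s). headed_words 1 r s \<times> headed_words 2 s (count_list c 1))"
    (is "bij_betw ?f ?A ?B")
proof (rule bij_betw_imageI)
  show "inj_on ?f ?A"
  proof (rule inj_onI)
    fix v w
    assume "v \<in> ?A" "w \<in> ?A" "?f v = ?f w"
    then show "v = w"
      by (intro split_inj[of 1 v w]) (simp_all add: words_rs_def words_def)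
  qed
  have "?f v \<in> ?B" if "v \<in> ?A" for v
  proof -
    have v: "capped 1 v" "length (filter odd v) = n" "length (filter even v) = k"
      "count_list v 1 = r" "count_list v 2 = s"
      using that by (auto simp: words_rs_def words_def)
    then have "hi v \<in> words (n - r) (k - s)"
      using capped_hi[OF v(1)] odd_hi[OF v(1)] even_hi[OF v(1)] v by (auto simp: words_def)
    moreover have "lo v \<in> headed_words 1 r s"
      using v set_lo[OF v(1)] hd_lo[OF v(1)] count_list_lo[of 1 v] count_list_lo[of 2 v]
      by (simp add: headed_words_def two_letter_words_def numeral_eq_Suc)
    moreover have "mid v \<in> headed_words 2 s (count_list (hi v) 1)"
      using v set_mid[of v] hd_mid[OF v(1)] count_list_mid[of 2 v] count_list_mid[of 3 v]
        count_list_hi[of v 0]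
      by (simp add: headed_words_def two_letter_words_def numeral_eq_Suc)
    ultimately show ?thesis
      by simp
  qed
  moreover have surj: "\<exists>v\<in>?A. ?f v = (c, a, m)" if "(c, a, m) \<in> ?B" for c a m
  proof -
    have c: "capped 1 c" "length (filter odd c) = n - r" "length (filter even c) = k - s"
      and a: "set a \<subseteq> {1, 2}" "count_list a 1 = r" "count_list a 2 = s" "a = [] \<or> hd a = 1"
      and m: "set m \<subseteq> {2, 3}" "count_list m 2 = s" "count_list m 3 = count_list c 1"
        "m = [] \<or> hd m = 2"
      using that by (auto simp: words_def headed_words_def two_letter_words_def numeral_eq_Suc)
    have "\<exists>v. capped 1 v \<and> lo v = a \<and> mid v = m \<and> hi v = c"
      using a m c by (intro split_surj) auto
    then obtain v where v: "capped 1 v" "lo v = a" "mid v = m" "hi v = c"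
      by blast
    then have "v \<in> ?A"
      using odd_hi[OF v(1)] even_hi[OF v(1)] count_list_lo[of 1 v] count_list_lo[of 2 v] a c assms
      by (simp add: words_rs_def words_def)
    then show ?thesis
      using v by auto
  qed
  ultimately show "?f ` ?A = ?B"
  proof (intro subset_antisym image_subsetI subsetI)
    fix x
    assume x: "x \<in> ?B"
    obtain c a m where "x = (c, a, m)"
      by (cases x)
    then show "x \<in> ?f ` ?A"
      using surj[of c a m] x by (metis (no_types, lifting) image_eqI)
  qed
qed

text \<open>The factor \<open>t_var ^ (n + k)\<close> is the unit per letter from
  \<open>half_sum_split\<close>, and \<open>q_var ^ r\<close> counts pairs with the leading 0.
  Allowing \<open>r = n\<close> lets this serve both the recursion and the boundary case.\<close>

lemma word_gf_split:
  assumes "r \<le> n" "s \<le> k" "0 < r"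
  shows "word_gf r s n k =
    (\<Sum>c\<in>words (n - r) (k - s).
       t_var ^ (n + k) * q_var ^ r * (q_var ^ s * q_binom q_var (s + r - 1) s)
       * (\<Sum>m\<in>headed_words 2 s (count_list c 1). q_var ^ succ_pairs m)
       * (t_var ^ half_sum c * q_var ^ succ_pairs c))"
proof -
  let ?g = "\<lambda>(c, a, m). t_var ^ (n + k) * q_var ^ r * q_var ^ succ_pairs a
    * q_var ^ succ_pairs m * (t_var ^ half_sum c * q_var ^ succ_pairs c)"
  have "word_weight v = ?g (hi v, lo v, mid v)" if "v \<in> words_rs r s n k" for v
  proof -
    have v: "capped 1 v" "length v = n + k" "count_list v 1 = r"
      using that length_odd_even[of v] by (auto simp: words_rs_def words_def)
    show ?thesis
      using succ_pairs_split[OF v(1)] half_sum_split[OF v(1)] v(2,3)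
      by (simp add: word_weight_def power_add)
  qed
  then have "word_gf r s n k = (\<Sum>v\<in>words_rs r s n k. ?g (hi v, lo v, mid v))"
    unfolding word_gf_def by (rule sum.cong[OF refl])
  also have "\<dots> = sum ?g (SIGMA c:words (n - r) (k - s).
      headed_words 1 r s \<times> headed_words 2 s (count_list c 1))"
    using assms by (intro sum.reindex_bij_betw split_bij_betw)
  also have "\<dots> = (\<Sum>c\<in>words (n - r) (k - s). \<Sum>a\<in>headed_words 1 r s.
      \<Sum>m\<in>headed_words 2 s (count_list c 1). ?g (c, a, m))"
    by (subst sum.Sigma[symmetric])
      (auto simp: finite_words finite_headed_words sum.cartesian_product intro!: sum.cong)
  also have "\<dots> = (\<Sum>c\<in>words (n - r) (k - s).
       t_var ^ (n + k) * q_var ^ r * (\<Sum>a\<in>headed_words 1 r s. q_var ^ succ_pairs a)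
       * (\<Sum>m\<in>headed_words 2 s (count_list c 1). q_var ^ succ_pairs m)
       * (t_var ^ half_sum c * q_var ^ succ_pairs c))"
    by (intro sum.cong refl, simp only: prod.case sum_distrib_left sum_distrib_right)
      (rule sum.swap)
  also have "(\<Sum>a\<in>headed_words 1 r s. q_var ^ succ_pairs a)
      = q_var ^ s * q_binom q_var (s + r - 1) s"
    using headed_words_gf[of r s 1] assms by (simp add: add.commute)
  finally show ?thesis .
qed

lemma count_list_le_length_filter: "P x \<Longrightarrow> count_list v x \<le> length (filter P v)"
  by (induction v) auto

lemma count_list_1_pos: "v \<in> words n k \<Longrightarrow> 0 < n \<Longrightarrow> 0 < count_list v 1"
  by (cases v) (auto simp: words_def)

text \<open>The words \<open>c\<close> are grouped by their numbers \<open>h\<close> and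
  \<open>j\<close> of letters 1 and 2. Here \<open>h\<close> is positive because a nonempty word
  capped by 1 begins with 1.\<close>

lemma word_gf_recursion:
  assumes "1 \<le> r" "r < n" "s \<le> k"
  shows "word_gf r s n k = t_var ^ (n + k) * q_var ^ r *
    (\<Sum>h = 1..n - r. \<Sum>j = 0..k - s.
       q_var ^ s * q_binom q_var (s + r - 1) s * q_binom q_var (s + h - 1) h *
       word_gf h j (n - r) (k - s))"
proof -
  let ?W = "words (n - r) (k - s)"
  let ?T = "{1..n - r} \<times> {0..k - s}"
  let ?g = "\<lambda>v. (count_list v 1, count_list v 2)"
  let ?w = "\<lambda>c. t_var ^ (n + k) * q_var ^ r * (q_var ^ s * q_binom q_var (s + r - 1) s
    * q_binom q_var (s + count_list c 1 - 1) (count_list c 1) * word_weight c)"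
  have pos: "0 < count_list c 1" if "c \<in> ?W" for c
    using count_list_1_pos that assms by simp
  have "word_gf r s n k = (\<Sum>c\<in>?W. ?w c)"
    unfolding word_gf_split[OF less_imp_le[OF assms(2)] assms(3) less_le_trans[OF zero_less_one assms(1)]]
  proof (rule sum.cong[OF refl])
    fix c
    assume "c \<in> ?W"
    then have "0 < s + count_list c 1"
      using pos by simp
    \<comment> \<open>The sum over \<open>m\<close> supplies a power of \<open>q_var\<close> with
      exponent \<open>count_list c 1\<close>, exactly what completes the last factor to
      \<open>word_weight c\<close>.\<close>
    then show "t_var ^ (n + k) * q_var ^ r * (q_var ^ s * q_binom q_var (s + r - 1) s)
       * (\<Sum>m\<in>headed_words 2 s (count_list c 1). q_var ^ succ_pairs m)
       * (t_var ^ half_sum c * q_var ^ succ_pairs c) = ?w c"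
      unfolding headed_words_gf[OF \<open>0 < s + count_list c 1\<close>] word_weight_def power_add
      by (simp only: mult_ac)
  qed
  also have "\<dots> = (\<Sum>y\<in>?T. \<Sum>c\<in>{c \<in> ?W. ?g c = y}. ?w c)"
  proof (rule sum.group[symmetric])
    show "?g ` ?W \<subseteq> ?T"
    proof (rule image_subsetI)
      fix c
      assume c: "c \<in> ?W"
      then have "0 < count_list c 1"
        by (rule pos)
      then show "?g c \<in> ?T"
        using c count_list_le_length_filter[of odd 1 c] count_list_le_length_filter[of even 2 c]
        by (simp add: words_def)
    qed
  qed (simp_all add: finite_words)
  also have "\<dots> = (\<Sum>(h, j)\<in>?T. t_var ^ (n + k) * q_var ^ r *
      (q_var ^ s * q_binom q_var (s + r - 1) s * q_binom q_var (s + h - 1) h *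
       word_gf h j (n - r) (k - s)))"
  proof (rule sum.cong[OF refl])
    fix y
    assume "y \<in> ?T"
    obtain h j where y: "y = (h, j)"
      by fastforce
    have set_eq: "{c \<in> ?W. ?g c = y} = words_rs h j (n - r) (k - s)"
      by (auto simp: y words_rs_def)
    have weight: "?w c = t_var ^ (n + k) * q_var ^ r *
      (q_var ^ s * q_binom q_var (s + r - 1) s * q_binom q_var (s + h - 1) h * word_weight c)"
      if "c \<in> words_rs h j (n - r) (k - s)" for c
      using that by (simp add: words_rs_def)
    show "(\<Sum>c\<in>{c \<in> ?W. ?g c = y}. ?w c) = (case y of (h, j) \<Rightarrow>
      t_var ^ (n + k) * q_var ^ r *
      (q_var ^ s * q_binom q_var (s + r - 1) s * q_binom q_var (s + h - 1) h *
       word_gf h j (n - r) (k - s)))"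
      unfolding set_eq unfolding y prod.case word_gf_def sum_distrib_left
      using weight by (rule sum.cong[OF refl])
  qed
  finally show ?thesis
    by (simp add: sum.cartesian_product[symmetric] sum_distrib_left)
qed

section \<open>The boundary case without large letters\<close>

lemma words_0: "words 0 k = (if k = 0 then {[]} else {})"
proof -
  have "v \<in> words 0 k \<longleftrightarrow> v = [] \<and> k = 0" for v
    by (cases v) (auto simp: words_def)
  then show ?thesis
    by auto
qed

text \<open>If all odd letters are 1, then \<open>hi\<close> has no odd letter and is empty, which
  forces \<open>s = k\<close>; the middle subword then consists of 2s only and has no pairs.\<close>

lemma word_gf_full:
  assumes "0 < n"
  shows "word_gf n s n k =
    (if s = k then (q_var * t_var) ^ (n + k) * q_binom q_var (k + n - 1) k else 0)"
proof (cases "s \<le> k")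
  case True
  have "headed_words 2 s 0 = {replicate s 2}" for s
    unfolding headed_words_def two_letter_words_0_right by (cases s) auto
  moreover have "(q_var * t_var) ^ (n + k) = t_var ^ (n + k) * q_var ^ n * q_var ^ k"
    by (simp only: power_mult_distrib power_add mult_ac)
  ultimately show ?thesis
    unfolding word_gf_split[OF le_refl True assms] diff_self_eq_0 words_0
    using True by (simp add: half_sum_def succ_pairs_replicate mult.assoc)
next
  case False
  have "count_list v 2 \<le> k" if "v \<in> words n k" for v
    using that count_list_le_length_filter[of even 2 v] by (simp add: words_def)
  with False have "words_rs n s n k = {}"
    by (auto simp: words_rs_def)
  then show ?thesis
    using False by (simp add: word_gf_def)
qed

section \<open>Pairs of paths as words\<close>

text \<open>A polyomino is read along antidiagonals: \<open>d\<close> is the distance between the two paths, and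
  \<open>Bar k\<close> and \<open>Plain k\<close> are encoded as \<open>2 * k\<close> and \<open>2 * k - 1\<close>, their ranks in the total order.\<close>

fun next_dist :: "nat \<Rightarrow> step \<times> step \<Rightarrow> nat" where
  "next_dist d (North, East) = Suc d"
| "next_dist d (North, North) = d"
| "next_dist d (East, East) = d"
| "next_dist d (East, North) = d - 1"

text \<open>A North step of the upper path carries the distance before it, an East step of the lower
  path the distance after it; this gives \<open>2 * d + 1\<close> in the first line.\<close>

fun step_letters :: "nat \<Rightarrow> step \<times> step \<Rightarrow> nat list" where
  "step_letters d (North, East) = [2 * d, 2 * d + 1]"
| "step_letters d (North, North) = [2 * d]"
| "step_letters d (East, East) = [2 * d - 1]"
| "step_letters d (East, North) = []"

fun word_of :: "nat \<Rightarrow> (step \<times> step) list \<Rightarrow> nat list" where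
  "word_of d [] = []"
| "word_of d (p # ps) = step_letters d p @ word_of (next_dist d p) ps"

text \<open>Starting at distance \<open>d\<close>, the two paths meet for the first time at their
  common end.\<close>

fun excursion :: "nat \<Rightarrow> (step \<times> step) list \<Rightarrow> bool" where
  "excursion d [] \<longleftrightarrow> d = 0"
| "excursion d (p # ps) \<longleftrightarrow> 0 < d \<and> excursion (next_dist d p) ps"

fun dist_sum :: "nat \<Rightarrow> (step \<times> step) list \<Rightarrow> nat" where
  "dist_sum d [] = 0"
| "dist_sum d (p # ps) = d + dist_sum (next_dist d p) ps"

lemma step_pair_cases:
  obtains "p = (North, East)" | "p = (North, North)" | "p = (East, East)" | "p = (East, North)"
  by (metis step.exhaust surj_pair)

text \<open>At distance \<open>d\<close> the next letter is at most \<open>2 * d\<close>. A pair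
  that raises the distance first writes \<open>2 * d\<close> and \<open>2 * d + 1\<close>, after
  which \<open>2 * d + 2\<close> is allowed.\<close>

lemma capped_word_of: "excursion d ps \<Longrightarrow> capped (2 * d) (word_of d ps)"
proof (induction ps arbitrary: d)
  case (Cons p ps)
  then have "capped (2 * next_dist d p) (word_of (next_dist d p) ps)" "0 < d"
    by auto
  then show ?case
    using capped_mono[of "2 * next_dist d p" "word_of (next_dist d p) ps" "2 * d"]
      capped_mono[of "2 * next_dist d p" "word_of (next_dist d p) ps" "Suc (2 * d)"]
    by (cases p rule: step_pair_cases) auto
qed simp

lemma capped_Cons_le:
  "x # w = v \<Longrightarrow> capped b v \<Longrightarrow> x \<le> b" "v = x # w \<Longrightarrow> capped b v \<Longrightarrow> x \<le> b"
  by auto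

text \<open>The caps tell the four step pairs apart: after \<open>(North, North)\<close> no
  \<open>2 * d + 1\<close> can follow directly, and after \<open>(East, North)\<close> the next
  letter is at most \<open>2 * (d - 1)\<close>.\<close>

lemma word_of_inj:
  "excursion d ps \<Longrightarrow> excursion d ps' \<Longrightarrow> word_of d ps = word_of d ps' \<Longrightarrow> ps = ps'"
proof (induction ps arbitrary: d ps')
  case Nil
  then show ?case
    by (cases ps') auto
next
  case (Cons p ps)
  then obtain p' qs where ps': "ps' = p' # qs"
    by (cases ps') auto
  have "capped (2 * next_dist d p) (word_of (next_dist d p) ps)"
    "capped (2 * next_dist d p') (word_of (next_dist d p') qs)" and "0 < d"
    using Cons.prems capped_word_of by (auto simp: ps')
  then have "p = p'"
    using Cons.prems(3) unfolding ps'
    by (cases p rule: step_pair_cases; cases p' rule: step_pair_cases)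
      (auto simp: Cons_eq_append_conv dest: capped_Cons_le)
  then show ?case
    using Cons by (auto simp: ps')
qed

text \<open>A letter \<open>2 * d\<close> comes from a pair of steps \<open>(North, East)\<close> iff it is followed by
  \<open>2 * d + 1\<close>; letters below \<open>2 * d - 1\<close> require a distance decreasing step first.\<close>

lemma word_of_surj: "capped (2 * d) v \<Longrightarrow> \<exists>ps. excursion d ps \<and> word_of d ps = v"
\<comment> \<open>The pair \<open>(North, East)\<close> raises \<open>d\<close> but consumes
  letters; \<open>(East, North)\<close> consumes none but lowers \<open>d\<close>.\<close>
proof (induction "2 * length v + d" arbitrary: d v rule: less_induct)
  case less
  consider "d = 0" "v = []"
    | w where "0 < d" "v = 2 * d # (2 * d + 1) # w"
    | w where "0 < d" "v = 2 * d # w" "capped (2 * d) w"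
    | w where "0 < d" "v = (2 * d - 1) # w" "capped (2 * d) w"
    | "0 < d" "capped (2 * (d - 1)) v"
  proof (cases v)
    case Nil
    then show ?thesis
      using that(1,5) by (cases "d = 0") auto
  next
    case (Cons x w)
    then have x: "1 \<le> x" "x \<le> 2 * d" "capped (Suc x) w"
      using less.prems by auto
    consider "x \<le> 2 * (d - 1)" | "x = 2 * d - 1" | "x = 2 * d"
      using x by linarith
    then show ?thesis
    proof cases
      case 1
      then show ?thesis
        using that(5) x Cons by auto
    next
      case 2
      then show ?thesis
        using that(4) x Cons by auto
    next
      case 3
      show ?thesis
      proof (cases "\<exists>w'. w = (2 * d + 1) # w'")
        case True
        then show ?thesis
          using that(2) x Cons 3 by auto
      next
        case False
        then have "capped (2 * d) w"
          using x(3) 3 by (cases w) auto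
        then show ?thesis
          using that(3) x Cons 3 by auto
      qed
    qed
  qed
  then show ?case
  proof cases
    case 1
    then show ?thesis
      by (intro exI[of _ "[]"]) simp
  next
    case 2
    then have "\<exists>ps. excursion (Suc d) ps \<and> word_of (Suc d) ps = w"
      using less.prems by (intro less.hyps) auto
    then show ?thesis
      using 2 by (metis append.simps excursion.simps(2) next_dist.simps(1) step_letters.simps(1)
        word_of.simps(2))
  next
    case 3
    then have "\<exists>ps. excursion d ps \<and> word_of d ps = w"
      by (intro less.hyps) auto
    then show ?thesis
      using 3 by (metis append.simps excursion.simps(2) next_dist.simps(2) step_letters.simps(2)
        word_of.simps(2))
  next
    case 4
    then have "\<exists>ps. excursion d ps \<and> word_of d ps = w"
      by (intro less.hyps) auto
    then show ?thesis
      using 4 by (metis append.simps excursion.simps(2) next_dist.simps(3) step_letters.simps(3)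
        word_of.simps(2))
  next
    case 5
    then have "\<exists>ps. excursion (d - 1) ps \<and> word_of (d - 1) ps = v"
      by (intro less.hyps) auto
    then show ?thesis
      using 5 by (metis append.simps(1) excursion.simps(2) next_dist.simps(4)
        step_letters.simps(4) word_of.simps(2))
  qed
qed

lemma odd_word_of:
  "excursion d ps \<Longrightarrow> length (filter odd (word_of d ps)) = count_list (map snd ps) East"
proof (induction ps arbitrary: d)
  case (Cons p ps)
  then show ?case
    by (cases p rule: step_pair_cases) auto
qed simp

lemma even_word_of:
  "excursion d ps \<Longrightarrow> length (filter even (word_of d ps)) = count_list (map fst ps) North"
proof (induction ps arbitrary: d)
  case (Cons p ps)
  then show ?case
    by (cases p rule: step_pair_cases) auto
qed simp

lemma half_sum_append: "half_sum (v @ w) = half_sum v + half_sum w"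
  by (simp add: half_sum_def)

text \<open>Half of \<open>d * Suc d\<close> is the distance sum of the straight descent from
  \<open>d\<close>, which writes no letters.\<close>

lemma half_sum_word_of:
  "excursion d ps \<Longrightarrow> 2 * half_sum (word_of d ps) + d * Suc d = 2 * dist_sum d ps"
proof (induction ps arbitrary: d)
  case Nil
  then show ?case
    by (simp add: half_sum_def)
next
  case (Cons p ps)
  then have IH: "2 * half_sum (word_of (next_dist d p) ps) + next_dist d p * Suc (next_dist d p)
      = 2 * dist_sum (next_dist d p) ps"
    and "0 < d"
    by auto
  then obtain d' where "d = Suc d'"
    using gr0_implies_Suc by blast
  with IH show ?case
    by (cases p rule: step_pair_cases) (auto simp: half_sum_append half_sum_def)
qed

lemma word_of_concat:
  assumes "\<And>i. i < length ps \<Longrightarrow> D (Suc i) = next_dist (D i) (ps ! i)"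
  shows "word_of (D 0) ps = concat (map (\<lambda>i. step_letters (D i) (ps ! i)) [0..<length ps])"
  using assms
proof (induction ps arbitrary: D)
  case (Cons p ps)
  have "word_of (D (Suc 0)) ps
      = concat (map (\<lambda>i. step_letters (D (Suc i)) (ps ! i)) [0..<length ps])"
    using Cons.prems by (intro Cons.IH[of "\<lambda>i. D (Suc i)"]) fastforce
  moreover have "D (Suc 0) = next_dist (D 0) p"
    using Cons.prems by fastforce
  ultimately show ?case
    by (simp add: upt_conv_Cons map_Suc_upt[symmetric] comp_def del: upt_Suc)
qed simp

lemma dist_sum_eq_sum:
  assumes "\<And>i. i < length ps \<Longrightarrow> D (Suc i) = next_dist (D i) (ps ! i)"
  shows "dist_sum (D 0) ps = (\<Sum>i<length ps. D i)"
  using assms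
proof (induction ps arbitrary: D)
  case (Cons p ps)
  have "dist_sum (D (Suc 0)) ps = (\<Sum>i<length ps. D (Suc i))"
    using Cons.prems by (intro Cons.IH[of "\<lambda>i. D (Suc i)"]) fastforce
  moreover have "D (Suc 0) = next_dist (D 0) p"
    using Cons.prems by fastforce
  ultimately show ?case
    by (simp add: sum.lessThan_Suc_shift del: sum.lessThan_Suc)
qed simp

section \<open>Coordinates along a path\<close>

definition easts :: "path \<Rightarrow> nat \<Rightarrow> nat" where
  "easts p i = count_list (take i p) East"

definition norths :: "path \<Rightarrow> nat \<Rightarrow> nat" where
  "norths p i = count_list (take i p) North"

lemma point_eq: "point p i = (easts p i, norths p i)"
  by (simp add: point_def easts_def norths_def)

lemma count_list_steps: "count_list p East + count_list p North = length p"
proof (induction p)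
  case (Cons d p)
  then show ?case
    by (cases d) auto
qed simp

lemma easts_norths: "easts p i + norths p i = min i (length p)"
  by (simp add: easts_def norths_def count_list_steps min.commute)

lemma easts_0 [simp]: "easts p 0 = 0"
  by (simp add: easts_def)

lemma easts_Cons_Suc: "easts (d # p) (Suc i) = of_bool (d = East) + easts p i"
  by (simp add: easts_def)

lemma easts_Suc: "i < length p \<Longrightarrow> easts p (Suc i) = easts p i + of_bool (p ! i = East)"
  by (simp add: easts_def take_Suc_conv_app_nth)

lemma norths_Suc: "i < length p \<Longrightarrow> norths p (Suc i) = norths p i + of_bool (p ! i = North)"
  by (simp add: norths_def take_Suc_conv_app_nth)

lemma easts_all: "length p \<le> i \<Longrightarrow> easts p i = count_list p East"
  by (simp add: easts_def)

lemma norths_mono: "i \<le> j \<Longrightarrow> norths p i \<le> norths p j"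
  unfolding norths_def by (metis count_list_append le_add1 min.absorb1 take_add le_Suc_ex)

lemma norths_le: "norths p i \<le> count_list p North"
  unfolding norths_def by (metis append_take_drop_id count_list_append le_add1)

text \<open>The distance before pair \<open>i\<close> is \<open>d\<close> plus the East steps of the
  lower path minus those of the upper path so far.\<close>

lemma excursion_iff:
  "excursion d ps \<longleftrightarrow>
     (\<forall>i<length ps. easts (map fst ps) i < d + easts (map snd ps) i)
     \<and> count_list (map fst ps) East = d + count_list (map snd ps) East"
proof (induction ps arbitrary: d)
  case (Cons p ps)
  show ?case
    by (cases p rule: step_pair_cases)
      (auto simp: Cons.IH All_less_Suc2 easts_Cons_Suc)
qed auto

section \<open>Interior squares\<close>

lemma paths_to_length: "p \<in> paths_to a b \<Longrightarrow> length p = a + b"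
  using count_list_steps[of p] by (simp add: paths_to_def)

text \<open>If \<open>u \<le> x\<close>, the North step in row \<open>y\<close> is finished by index
  \<open>x + y + 1\<close>, so the height there exceeds \<open>y\<close>; otherwise it has not begun
  and the height is at most \<open>y\<close>.\<close>

lemma north_step_le_iff:
  assumes "i < length p" "p ! i = North" "point p i = (u, y)"
  shows "u \<le> x \<longleftrightarrow> easts p (x + y + 1) \<le> x"
proof -
  have u: "easts p i = u" "norths p i = y" "u + y = i"
    using assms easts_norths[of p i] by (simp_all add: point_eq)
  show ?thesis
  proof
    assume "u \<le> x"
    then have "norths p (Suc i) \<le> norths p (x + y + 1)"
      using u by (intro norths_mono) simp
    then show "easts p (x + y + 1) \<le> x"
      using easts_norths[of p "x + y + 1"] norths_Suc[of i p] assms u by simp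
  next
    assume le: "easts p (x + y + 1) \<le> x"
    show "u \<le> x"
    proof (rule ccontr)
      assume "\<not> u \<le> x"
      then have "norths p (x + y + 1) \<le> norths p i"
        using u by (intro norths_mono) simp
      then show False
        using easts_norths[of p "x + y + 1"] le u \<open>\<not> u \<le> x\<close> assms(1) by simp
    qed
  qed
qed

lemma ex_north_step: "y < count_list p North \<Longrightarrow> \<exists>i<length p. p ! i = North \<and> norths p i = y"
proof (induction p rule: rev_induct)
  case (snoc d p)
  show ?case
  proof (cases "y < count_list p North")
    case True
    then obtain i where "i < length p" "p ! i = North" "norths p i = y"
      using snoc.IH by blast
    then show ?thesis
      by (intro exI[of _ i]) (simp add: nth_append norths_def)
  next
    case False
    then have "d = North" "y = count_list p North"
      using snoc.prems by (auto split: if_splits)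
    then show ?thesis
      by (intro exI[of _ "length p"]) (simp add: norths_def)
  qed
qed simp

text \<open>The antidiagonal of the square \<open>(x, y)\<close> joins the points \<open>(x + 1, y)\<close> and \<open>(x, y + 1)\<close>;
  the square is interior iff this segment lies between the points of the two paths on it.\<close>

lemma interior_squares_iff:
  assumes "U \<in> paths_to a b" "L \<in> paths_to a b"
  shows "(x, y) \<in> interior_squares (U, L) \<longleftrightarrow>
    easts U (x + y + 1) \<le> x \<and> x < easts L (x + y + 1)"
proof
  assume "(x, y) \<in> interior_squares (U, L)"
  then obtain u l i k where
    "i < length U" "U ! i = North" "point U i = (u, y)"
    "k < length L" "L ! k = North" "point L k = (l, y)" "u \<le> x" "x < l"
    by (auto simp: interior_squares_def step_from_def)
  then show "easts U (x + y + 1) \<le> x \<and> x < easts L (x + y + 1)"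
    using north_step_le_iff[of i U u y x] north_step_le_iff[of k L l y x] by simp
next
  assume le: "easts U (x + y + 1) \<le> x \<and> x < easts L (x + y + 1)"
  have len: "length U = a + b" "length L = a + b"
    using assms by (simp_all add: paths_to_length)
  have "x + y + 1 \<le> a + b"
  proof (rule ccontr)
    assume "\<not> x + y + 1 \<le> a + b"
    then show False
      using easts_all[of U "x + y + 1"] easts_all[of L "x + y + 1"] le len assms
      by (simp add: paths_to_def)
  qed
  then have "y < norths U (x + y + 1)"
    using easts_norths[of U "x + y + 1"] le len by simp
  then have "y < b"
    using norths_le[of U "x + y + 1"] assms by (simp add: paths_to_def)
  then obtain i k where
    "i < length U" "U ! i = North" "norths U i = y" "k < length L" "L ! k = North" "norths L k = y"
    using ex_north_step[of y U] ex_north_step[of y L] assms by (auto simp: paths_to_def)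
  moreover from this have "easts U i \<le> x" "x < easts L k"
    using north_step_le_iff[of i U "easts U i" y x] north_step_le_iff[of k L "easts L k" y x] le
    by (auto simp: point_eq)
  ultimately show "(x, y) \<in> interior_squares (U, L)"
    by (auto simp: interior_squares_def step_from_def point_eq)
qed

text \<open>Squares are grouped by \<open>j = x + y\<close>; those in one group have consecutive
  \<open>x\<close> between the two paths on antidiagonal \<open>Suc j\<close>.\<close>

lemma area_eq_sum:
  assumes "U \<in> paths_to a b" "L \<in> paths_to a b"
  shows "area (U, L) = (\<Sum>j<a + b. easts L (Suc j) - easts U (Suc j))"
proof -
  let ?S = "SIGMA j:{..<a + b}. {easts U (Suc j)..<easts L (Suc j)}"
  have le: "x \<le> j" if "x < easts L (Suc j)" for x j
    using easts_norths[of L "Suc j"] that by simp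
  have "bij_betw (\<lambda>(x, y). (x + y, x)) (interior_squares (U, L)) ?S"
  proof (rule bij_betw_byWitness[where f' = "\<lambda>(j, x). (x, j - x)"])
    show "(\<lambda>(x, y). (x + y, x)) ` interior_squares (U, L) \<subseteq> ?S"
    proof clarify
      fix x y
      assume "(x, y) \<in> interior_squares (U, L)"
      then have "easts U (Suc (x + y)) \<le> x" "x < easts L (Suc (x + y))"
        using interior_squares_iff[OF assms] by simp_all
      moreover have "x + y < a + b"
      proof (rule ccontr)
        assume "\<not> x + y < a + b"
        then have "easts U (Suc (x + y)) = a" "easts L (Suc (x + y)) = a"
          using assms by (auto simp: easts_all paths_to_length) (simp_all add: paths_to_def)
        then show False
          using calculation by simp
      qed
      ultimately show "x + y \<in> {..<a + b} \<and> x \<in> {easts U (Suc (x + y))..<easts L (Suc (x + y))}"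
        by simp
    qed
    show "(\<lambda>(j, x). (x, j - x)) ` ?S \<subseteq> interior_squares (U, L)"
      using le by (auto simp: interior_squares_iff[OF assms])
    show "\<forall>z\<in>?S. (case case z of (j, x) \<Rightarrow> (x, j - x) of (x, y) \<Rightarrow> (x + y, x)) = z"
      using le by auto
  qed auto
  then have "area (U, L) = card ?S"
    by (simp add: area_def bij_betw_same_card)
  then show ?thesis
    by simp
qed

section \<open>The area word of a polyomino\<close>

lemma mem_path_points_iff:
  "(u, w) \<in> path_points p \<longleftrightarrow> u + w \<le> length p \<and> easts p (u + w) = u"
proof
  assume "(u, w) \<in> path_points p"
  then obtain i where "i \<le> length p" "u = easts p i" "w = norths p i"
    by (auto simp: path_points_def point_eq)
  then show "u + w \<le> length p \<and> easts p (u + w) = u"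
    using easts_norths[of p i] by simp
next
  assume "u + w \<le> length p \<and> easts p (u + w) = u"
  moreover from this have "norths p (u + w) = w"
    using easts_norths[of p "u + w"] by simp
  ultimately have "point p (u + w) = (u, w)" "u + w \<le> length p"
    by (simp_all add: point_eq)
  then show "(u, w) \<in> path_points p"
    unfolding path_points_def by (metis (mono_tags, lifting) mem_Collect_eq)
qed

text \<open>The line runs along antidiagonal \<open>Suc i\<close>, where the upper path has exactly
  one point, so only one value of \<open>k\<close> competes for the minimum.\<close>

lemma east_label_eq:
  assumes "i < length L" "L ! i = East" "length U = length L"
    and le: "easts U (Suc i) \<le> easts L (Suc i)"
  shows "east_label (U, L) (point L i) = easts L (Suc i) - easts U (Suc i)"
proof -
  have i: "easts L i + norths L i = i" "easts L (Suc i) = easts L i + 1"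
    using easts_norths[of L i] easts_Suc[of i L] assms by simp_all
  have "(\<exists>u. u + k = easts L i + 1 \<and> (u, norths L i + k) \<in> path_points U)
      \<longleftrightarrow> k = easts L (Suc i) - easts U (Suc i)" for k
  proof
    assume "\<exists>u. u + k = easts L i + 1 \<and> (u, norths L i + k) \<in> path_points U"
    then obtain u where u: "u + k = easts L i + 1" "easts U (u + (norths L i + k)) = u"
      by (auto simp: mem_path_points_iff)
    moreover have "u + (norths L i + k) = Suc i"
      using u(1) i by linarith
    ultimately show "k = easts L (Suc i) - easts U (Suc i)"
      using i by simp
  next
    assume k: "k = easts L (Suc i) - easts U (Suc i)"
    then have "easts U (Suc i) + k = easts L i + 1"
      "easts U (Suc i) + (norths L i + k) = Suc i"
      using le i by linarith+
    then show "\<exists>u. u + k = easts L i + 1 \<and> (u, norths L i + k) \<in> path_points U"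
      using assms(1,3) by (intro exI[of _ "easts U (Suc i)"]) (simp only: mem_path_points_iff, simp)
  qed
  then show ?thesis
    by (simp add: east_label_def point_eq Least_equality)
qed

text \<open>The line of step \<open>i\<close> crosses precisely the squares between the paths with
  \<open>x + y = i\<close>; so a square is crossed iff the lower path goes East at index
  \<open>x + y\<close>.\<close>

lemma crossed_squares_iff:
  assumes "length U = length L" and le: "\<And>i. easts U i \<le> easts L i"
  shows "(x, y) \<in> crossed_squares (U, L) \<longleftrightarrow>
    x + y < length L \<and> L ! (x + y) = East \<and>
    easts U (Suc (x + y)) \<le> x \<and> x < easts L (Suc (x + y))"
proof -
  have line: "(x, y) \<in> line_squares (U, L) (point L i) \<longleftrightarrow>
      x + y = i \<and> easts U (Suc i) \<le> x \<and> x < easts L (Suc i)"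
    if "i < length L" "L ! i = East" for i
  proof -
    have i: "easts L i + norths L i = i" "easts L (Suc i) = easts L i + 1"
      using easts_norths[of L i] easts_Suc[of i L] that by simp_all
    have "(x, y) \<in> line_squares (U, L) (point L i) \<longleftrightarrow>
        (\<exists>j<easts L (Suc i) - easts U (Suc i). x + j = easts L i \<and> y = norths L i + j)"
      using east_label_eq[of i L U] that assms by (simp add: line_squares_def point_eq)
    also have "\<dots> \<longleftrightarrow> x + y = i \<and> easts U (Suc i) \<le> x \<and> x < easts L (Suc i)"
    proof
      assume "x + y = i \<and> easts U (Suc i) \<le> x \<and> x < easts L (Suc i)"
      then show "\<exists>j<easts L (Suc i) - easts U (Suc i). x + j = easts L i \<and> y = norths L i + j"
        using i by (intro exI[of _ "easts L i - x"]) linarith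
    qed (use i in auto)
    finally show ?thesis .
  qed
  have "(x, y) \<in> crossed_squares (U, L) \<longleftrightarrow>
      (\<exists>i<length L. L ! i = East \<and> (x, y) \<in> line_squares (U, L) (point L i))"
    unfolding crossed_squares_def step_from_def snd_conv by blast
  then show ?thesis
    using line by auto
qed

lemma card_north_steps:
  assumes "i \<le> k" "k \<le> length p"
  shows "card {j. i \<le> j \<and> j < k \<and> p ! j = North} = norths p k - norths p i"
  using assms
proof (induction k rule: dec_induct)
  case (step k)
  have eq: "{j. i \<le> j \<and> j < Suc k \<and> p ! j = North} =
      (if p ! k = North then insert k {j. i \<le> j \<and> j < k \<and> p ! j = North}
       else {j. i \<le> j \<and> j < k \<and> p ! j = North})"
    using step.hyps by (auto simp: less_Suc_eq)
  show ?case
    unfolding eq using step norths_Suc[of k p] norths_mono[of i k p] by (auto simp: Suc_diff_le)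
qed auto

text \<open>If \<open>k\<close> is the index of the lower path's North step in row \<open>y\<close>,
  the row's squares between the paths have indices from \<open>i\<close> to \<open>k - 1\<close>.
  The uncrossed ones match the lower path's North steps there, of which there are
  \<open>y - norths L i\<close>.\<close>

lemma north_label_eq:
  assumes U: "U \<in> paths_to a b" and L: "L \<in> paths_to a b" and le: "\<And>i. easts U i \<le> easts L i"
    and i: "i < length U" "U ! i = North"
  shows "north_label (U, L) (point U i) = easts L i - easts U i"
proof -
  define y where "y = norths U i"
  have len: "length U = a + b" "length L = a + b"
    using U L by (simp_all add: paths_to_length)
  have iU: "easts U i + y = i"
    using easts_norths[of U i] i by (simp add: y_def)
  have iL: "easts L i + norths L i = i"
    using easts_norths[of L i] i len by simp
  have "y < b"
    using norths_Suc[of i U] norths_le[of U "Suc i"] i U by (simp add: y_def paths_to_def)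
  then obtain k where k: "k < length L" "L ! k = North" "norths L k = y"
    using ex_north_step[of y L] L by (auto simp: paths_to_def)
  have kL: "easts L k + y = k"
    using easts_norths[of L k] k by simp
  have "norths L i \<le> y"
    using le[of i] iU iL by simp
  have "i \<le> k"
  proof (rule ccontr)
    assume "\<not> i \<le> k"
    then have "norths L (Suc k) \<le> norths L i"
      by (intro norths_mono) simp
    then show False
      using norths_Suc[of k L] k \<open>norths L i \<le> y\<close> by simp
  qed
  have row: "easts U (Suc (x + y)) \<le> x \<and> x < easts L (Suc (x + y)) \<longleftrightarrow> i \<le> x + y \<and> x + y < k"
    for x
    using north_step_le_iff[of i U "easts U i" y x] north_step_le_iff[of k L "easts L k" y x]
      i k iU kL by (auto simp: point_eq y_def)
  have "{(x, y'). (x, y') \<in> interior_squares (U, L) - crossed_squares (U, L) \<and> y' = y}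
      = (\<lambda>j. (j - y, y)) ` {j. i \<le> j \<and> j < k \<and> L ! j = North}" (is "?A = ?f ` ?B")
  proof (intro subset_antisym subsetI)
    fix z
    assume "z \<in> ?A"
    then obtain x where x: "z = (x, y)" "(x, y) \<in> interior_squares (U, L)"
      "(x, y) \<notin> crossed_squares (U, L)"
      by auto
    then have "x + y \<in> ?B"
      using row[of x] k crossed_squares_iff[of U L x y] le len interior_squares_iff[OF U L, of x y]
        step.exhaust[of "L ! (x + y)"]
      by auto
    then show "z \<in> ?f ` ?B"
      using x by (intro image_eqI[of _ _ "x + y"]) simp_all
  next
    fix z
    assume "z \<in> ?f ` ?B"
    then obtain j where j: "z = (j - y, y)" "i \<le> j" "j < k" "L ! j = North"
      by auto
    then have "j - y + y = j"
      using iU by simp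
    then show "z \<in> ?A"
      using j row[of "j - y"] crossed_squares_iff[of U L "j - y" y] le len
        interior_squares_iff[OF U L, of "j - y" y]
      by simp
  qed
  moreover have "inj_on ?f ?B"
    by (rule inj_onI) (use iU in auto)
  ultimately have "north_label (U, L) (point U i) = card ?B"
    by (simp add: north_label_def point_eq y_def[symmetric] card_image)
  also have "\<dots> = easts L i - easts U i"
    using card_north_steps[of i k L] \<open>i \<le> k\<close> k iU iL by simp
  finally show ?thesis .
qed

section \<open>Polyominoes as excursions of the distance\<close>

text \<open>The paths are separated after one step, and each later step brings them closer by at
  most one, so they cannot cross without sharing a point.\<close>

lemma meet_only_at_ends_iff:
  assumes U: "North # U \<in> paths_to a b" and L: "East # L \<in> paths_to a b"
  shows "path_points (North # U) \<inter> path_points (East # L) = {(0, 0), (a, b)} \<longleftrightarrow>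
    (\<forall>i. 0 < i \<and> i < a + b \<longrightarrow> easts (North # U) i < easts (East # L) i)"
    (is "?meet \<longleftrightarrow> ?below")
proof -
  let ?U = "North # U" and ?L = "East # L"
  note len = paths_to_length[OF U] paths_to_length[OF L]
  have mem: "(u, w) \<in> path_points ?U \<inter> path_points ?L \<longleftrightarrow>
      u + w \<le> a + b \<and> easts ?U (u + w) = u \<and> easts ?L (u + w) = u" for u w
    by (auto simp only: Int_iff mem_path_points_iff len)
  have all: "easts ?U (a + b) = a" "easts ?L (a + b) = a"
    using U L len easts_all[of ?U "a + b"] easts_all[of ?L "a + b"]
    by (simp_all only: paths_to_def mem_Collect_eq order_refl)
  show ?thesis
  proof
    assume meet: ?meet
    have ne: "easts ?U i \<noteq> easts ?L i" if "0 < i" "i < a + b" for i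
    proof
      assume eq: "easts ?U i = easts ?L i"
      define w where "w = i - easts ?U i"
      have "easts ?U i + w = i"
        using easts_norths[of ?U i] len that unfolding w_def by linarith
      then have "(easts ?U i, w) \<in> path_points ?U \<inter> path_points ?L"
        using eq that unfolding mem by simp
      then have "easts ?U i + w = 0 \<or> easts ?U i + w = a + b"
        unfolding meet by auto
      then show False
        using \<open>easts ?U i + w = i\<close> that by simp
    qed
    have "0 < i \<longrightarrow> i < a + b \<longrightarrow> easts ?U i < easts ?L i" for i
    proof (induction i)
      case (Suc i)
      show ?case
      proof (cases "i = 0")
        case True
        then show ?thesis
          by (simp add: easts_Cons_Suc)
      next
        case False
        show ?thesis
        proof (intro impI)
          assume "Suc i < a + b"
          then have "easts ?U i < easts ?L i" "easts ?U (Suc i) \<noteq> easts ?L (Suc i)"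
            using Suc False ne[of "Suc i"] by simp_all
          moreover have "easts ?U (Suc i) \<le> Suc (easts ?U i)" "easts ?L i \<le> easts ?L (Suc i)"
            using easts_Suc[of i ?U] easts_Suc[of i ?L] len \<open>Suc i < a + b\<close> by simp_all
          ultimately show "easts ?U (Suc i) < easts ?L (Suc i)"
            by linarith
        qed
      qed
    qed simp
    then show ?below
      by blast
  next
    assume below: ?below
    have meet: "(u, w) \<in> path_points ?U \<inter> path_points ?L \<longleftrightarrow> (u, w) \<in> {(0, 0), (a, b)}" for u w
    proof
      assume "(u, w) \<in> path_points ?U \<inter> path_points ?L"
      then have u: "u + w \<le> a + b" "easts ?U (u + w) = u" "easts ?L (u + w) = u"
        unfolding mem by simp_all
      then have "\<not> (0 < u + w \<and> u + w < a + b)"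
        using below[rule_format, of "u + w"] u(2,3) by linarith
      then have "u + w = 0 \<or> u + w = a + b"
        using u(1) by linarith
      then show "(u, w) \<in> {(0, 0), (a, b)}"
        using u(2) all by auto
    next
      assume "(u, w) \<in> {(0, 0), (a, b)}"
      then show "(u, w) \<in> path_points ?U \<inter> path_points ?L"
        unfolding mem using all by auto
    qed
    show ?meet
      by (intro equalityI subrelI) (simp_all only: meet)
  qed
qed

text \<open>The two removed first steps bring the distance from 0 to 1 and shift indices by one; the
  common endpoint makes the final distance 0.\<close>

lemma below_iff_excursion:
  assumes U: "North # U \<in> paths_to a b" and L: "East # L \<in> paths_to a b"
  shows "(\<forall>i. 0 < i \<and> i < a + b \<longrightarrow> easts (North # U) i < easts (East # L) i) \<longleftrightarrow>
    excursion 1 (zip U L)"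
proof -
  have len: "a + b = Suc (length U)" "length L = length U"
    using paths_to_length[OF U] paths_to_length[OF L] by simp_all
  have "count_list U East = 1 + count_list L East"
    using U L by (simp add: paths_to_def)
  then have "excursion 1 (zip U L) \<longleftrightarrow> (\<forall>i<length U. easts U i < 1 + easts L i)"
    using len by (simp add: excursion_iff)
  also have "\<dots> \<longleftrightarrow>
      (\<forall>i. 0 < i \<and> i < a + b \<longrightarrow> easts (North # U) i < easts (East # L) i)"
    unfolding len(1) by (auto simp: easts_Cons_Suc gr0_conv_Suc)
  finally show ?thesis
    by blast
qed

lemma Polyo_iff:
  "(U, L) \<in> Polyo a b \<longleftrightarrow> U \<in> paths_to a b \<and> L \<in> paths_to a b \<and>
     (\<exists>U' L'. U = North # U' \<and> L = East # L' \<and> excursion 1 (zip U' L'))"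
proof -
  define meets where "meets U L \<longleftrightarrow> path_points U \<inter> path_points L = {(0, 0), (a, b)}" for U L
  have "(U, L) \<in> Polyo a b \<longleftrightarrow> (\<exists>U' L'. U = North # U' \<and> L = East # L' \<and>
      U \<in> paths_to a b \<and> L \<in> paths_to a b \<and> meets U L)"
    unfolding Polyo_def meets_def by (cases U; cases L) auto
  moreover have "meets (North # U') (East # L') \<longleftrightarrow> excursion 1 (zip U' L')"
    if "North # U' \<in> paths_to a b" "East # L' \<in> paths_to a b" for U' L'
    unfolding meets_def
    by (rule trans[OF meet_only_at_ends_iff[OF that] below_iff_excursion[OF that]])
  ultimately show ?thesis
    by auto
qed

section \<open>Area, area word and dinv in terms of ranks\<close>

definition letter_of :: "nat \<Rightarrow> letter" where
  "letter_of x = (if even x then Bar (x div 2) else Plain ((x + 1) div 2))"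

lemma inj_letter_of: "inj letter_of"
  by (rule injI) (auto simp: letter_of_def elim!: evenE oddE split: if_splits)

lemma next_letter_letter_of: "next_letter (letter_of x) = letter_of (Suc x)"
  by (auto simp: letter_of_def elim!: evenE oddE)

definition polyo_word :: "path \<times> path \<Rightarrow> nat list" where
  "polyo_word P = 1 # word_of 1 (zip (tl (fst P)) (tl (snd P)))"

lemma
  assumes P: "P \<in> Polyo a b"
  shows area_word_eq: "area_word P = map letter_of (0 # polyo_word P)"
    and area_eq: "area P = half_sum (polyo_word P)"
proof -
  obtain U L where P_eq: "P = (North # U, East # L)"
    and U: "North # U \<in> paths_to a b" and L: "East # L \<in> paths_to a b"
    and exc: "excursion 1 (zip U L)"
    using P by (cases P) (auto simp: Polyo_iff)
  let ?U = "North # U" and ?L = "East # L"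
  define D where "D i = easts ?L i - easts ?U i" for i
  note len = paths_to_length[OF U] paths_to_length[OF L]
  have below: "easts ?U i < easts ?L i" if "0 < i" "i < a + b" for i
    using below_iff_excursion[OF U L] exc that by blast
  have all: "easts ?U i = a" "easts ?L i = a" if "a + b \<le> i" for i
    using easts_all[of ?U i] easts_all[of ?L i] U L that len
    by (simp_all only: paths_to_def mem_Collect_eq)
  have le: "easts ?U i \<le> easts ?L i" for i
  proof -
    consider "i = 0" | "0 < i" "i < a + b" | "a + b \<le> i"
      by linarith
    then show ?thesis
      by cases (use below[of i] all[of i] in auto)
  qed
  have zip: "zip ?U ?L ! i = (?U ! i, ?L ! i)" if "i < length (zip ?U ?L)" for i
    using that by (intro nth_zip) auto
  have D_Suc: "D (Suc i) = next_dist (D i) (zip ?U ?L ! i)" if "i < length (zip ?U ?L)" for i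
  proof -
    have "easts ?U (Suc i) = easts ?U i + of_bool (?U ! i = East)"
      "easts ?L (Suc i) = easts ?L i + of_bool (?L ! i = East)"
      using that by (intro easts_Suc; simp)+
    then show ?thesis
      unfolding D_def zip[OF that] using le[of i] le[of "Suc i"]
      by (cases "?U ! i"; cases "?L ! i") (simp_all only: next_dist.simps, auto)
  qed
  have lenzip: "length (zip ?U ?L) = a + b"
    using len by simp
  have word_concat: "word_of (D 0) (zip ?U ?L)
      = concat (map (\<lambda>i. step_letters (D i) (zip ?U ?L ! i)) [0..<a + b])"
    by (rule word_of_concat[of "zip ?U ?L" D, unfolded lenzip]) (rule D_Suc[unfolded lenzip])
  have dist_concat: "dist_sum (D 0) (zip ?U ?L) = (\<Sum>i<a + b. D i)"
    by (rule dist_sum_eq_sum[of "zip ?U ?L" D, unfolded lenzip]) (rule D_Suc[unfolded lenzip])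
  have D0: "D 0 = 0"
    by (simp add: D_def)
  have word: "word_of 0 (zip ?U ?L) = 0 # polyo_word P" "dist_sum 0 (zip ?U ?L) = dist_sum 1 (zip U L)"
    by (simp_all add: polyo_word_def P_eq)
  have letters: "(if ?U ! i = North then [Bar (north_label (?U, ?L) (point ?U i))] else []) @
      (if ?L ! i = East then [Plain (east_label (?U, ?L) (point ?L i))] else [])
      = map letter_of (step_letters (D i) (zip ?U ?L ! i))" if "i < a + b" for i
  proof -
    have north: "north_label (?U, ?L) (point ?U i) = D i" if "?U ! i = North"
      unfolding D_def using north_label_eq[OF U L le] that \<open>i < a + b\<close> len by metis
    have east: "east_label (?U, ?L) (point ?L i) = D (Suc i)" if "?L ! i = East"
      unfolding D_def using east_label_eq[of i ?L ?U] that \<open>i < a + b\<close> len le by metis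
    have next_D: "D (Suc i) = next_dist (D i) (?U ! i, ?L ! i)"
      using D_Suc zip that lenzip by metis
    \<comment> \<open>This keeps \<open>2 * D i - 1\<close>, the letter of
      \<open>(East, East)\<close>, from being truncated.\<close>
    have pos: "0 < D i" if "?U ! i = East"
      using that \<open>i < a + b\<close> below[of i] by (cases i) (auto simp: D_def)
    have "zip ?U ?L ! i = (?U ! i, ?L ! i)"
      using zip that lenzip by metis
    then show ?thesis
      using north east next_D pos
      by (cases "?U ! i"; cases "?L ! i") (auto simp: letter_of_def)
  qed
  have "area_word P = concat (map (\<lambda>i. map letter_of (step_letters (D i) (zip ?U ?L ! i)))
      [0..<a + b])"
    unfolding area_word_def P_eq fst_conv snd_conv len
    by (intro arg_cong[of _ _ concat] map_cong refl letters) simp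
  also have "\<dots> = map letter_of (word_of (D 0) (zip ?U ?L))"
    unfolding word_concat by (simp only: map_concat map_map comp_def)
  finally show "area_word P = map letter_of (0 # polyo_word P)"
    unfolding D0 word .
  have "area P = (\<Sum>j<a + b. D (Suc j))"
    unfolding P_eq area_eq_sum[OF U L] D_def ..
  \<comment> \<open>The area sums the distances from index 1 on, \<open>dist_sum\<close> from index
    0 on; they agree since \<open>D\<close> vanishes at both ends.\<close>
  also have "\<dots> = (\<Sum>j<a + b. D j) + D (a + b) - D 0"
    using sum.lessThan_Suc_shift[of D "a + b"] by simp
  also have "\<dots> = dist_sum 1 (zip U L)"
    using dist_concat all[of "a + b"] unfolding D0 word(2) by (simp add: D_def)
  \<comment> \<open>The leading letter 1 contributes 1, the correction in
    \<open>half_sum_word_of\<close> at \<open>d = 1\<close>.\<close>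
  also have "\<dots> = half_sum (polyo_word P)"
    using half_sum_word_of[OF exc] by (simp add: polyo_word_def P_eq half_sum_def)
  finally show "area P = half_sum (polyo_word P)" .
qed

lemma count_list_eq_card: "count_list w y = card {j. j < length w \<and> w ! j = y}"
  by (simp add: count_list_eq_length_filter length_filter_conv_card eq_commute)

lemma card_succ_pairs:
  "card {(i, j). i < j \<and> j < length v \<and> v ! j = Suc (v ! i)} = succ_pairs v"
proof (induction v)
  case (Cons x v)
  let ?S = "\<lambda>v. {(i, j). i < j \<and> j < length v \<and> v ! j = Suc (v ! i)}"
  let ?A = "(\<lambda>j. (0::nat, Suc j)) ` {j. j < length v \<and> v ! j = Suc x}"
  let ?B = "(\<lambda>(i, j). (Suc i, Suc j)) ` ?S v"
  have fin: "finite (?S w)" for w :: "nat list"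
    by (rule finite_subset[of _ "{..<length w} \<times> {..<length w}"]) auto
  have "?S (x # v) = ?A \<union> ?B"
  proof (intro set_eqI)
    fix z :: "nat \<times> nat"
    obtain i j where "z = (i, j)"
      by fastforce
    then show "z \<in> ?S (x # v) \<longleftrightarrow> z \<in> ?A \<union> ?B"
      by (cases i; cases j) (auto simp: image_iff)
  qed
  moreover have "card (?A \<union> ?B) = card ?A + card ?B"
    using fin by (intro card_Un_disjoint) auto
  moreover have "card ?A = count_list v (Suc x)"
    by (simp add: card_image inj_on_def count_list_eq_card)
  moreover have "card ?B = succ_pairs v"
    unfolding Cons.IH[symmetric] by (rule card_image) (auto simp: inj_on_def)
  ultimately show ?case
    by simp
qed simp

text \<open>Since \<open>letter_of\<close> is injective and turns \<open>Suc\<close> into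
  \<open>next_letter\<close>, dinv counts successive ranks; the leading 0 pairs with every
  1.\<close>

lemma dinv_eq:
  assumes "P \<in> Polyo a b"
  shows "dinv P = count_list (polyo_word P) 1 + succ_pairs (polyo_word P)"
proof -
  let ?w = "0 # polyo_word P"
  have "{(i, j). i < j \<and> j < length (map letter_of ?w) \<and>
      map letter_of ?w ! j = next_letter (map letter_of ?w ! i)}
      = {(i, j). i < j \<and> j < length ?w \<and> ?w ! j = Suc (?w ! i)}"
    using inj_letter_of
    by (auto simp del: list.map nth_Cons_Suc simp: nth_map next_letter_letter_of inj_eq)
  then have "dinv P = succ_pairs ?w"
    unfolding dinv_def area_word_eq[OF assms] card_succ_pairs[symmetric] by simp
  then show ?thesis
    by simp
qed

section \<open>Transfer from words to polyominoes\<close>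

lemma polyo_word_bij_betw:
  assumes "0 < n" "0 < m"
  shows "bij_betw polyo_word (Polyo n m) (words n (m - 1))"
proof (rule bij_betw_imageI)
  show "inj_on polyo_word (Polyo n m)"
  proof (rule inj_onI, clarify)
    fix U L V M
    assume "(U, L) \<in> Polyo n m" "(V, M) \<in> Polyo n m"
      and eq: "polyo_word (U, L) = polyo_word (V, M)"
    then obtain U' L' V' M' where *: "U = North # U'" "L = East # L'" "V = North # V'"
      "M = East # M'" "excursion 1 (zip U' L')" "excursion 1 (zip V' M')"
      and paths: "U \<in> paths_to n m" "L \<in> paths_to n m" "V \<in> paths_to n m" "M \<in> paths_to n m"
      by (auto simp: Polyo_iff)
    have "zip U' L' = zip V' M'"
      using eq * by (intro word_of_inj[of 1]) (simp_all add: polyo_word_def)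
    moreover have "length U' = length L'" "length V' = length M'"
      using paths[THEN paths_to_length] * by simp_all
    ultimately have "U' = V'" "L' = M'"
      by (metis map_fst_zip, metis map_snd_zip)
    then show "U = V \<and> L = M"
      using * by blast
  qed
  have "polyo_word (U, L) \<in> words n (m - 1)" if P: "(U, L) \<in> Polyo n m" for U L
  proof -
    obtain U' L' where *: "U = North # U'" "L = East # L'" "excursion 1 (zip U' L')"
      "U \<in> paths_to n m" "L \<in> paths_to n m"
      using P by (auto simp: Polyo_iff)
    moreover have "length U' = length L'"
      using * paths_to_length[of U n m] paths_to_length[of L n m] by simp
    ultimately show ?thesis
      using capped_word_of[of 1 "zip U' L'"] odd_word_of[of 1 "zip U' L'"]
        even_word_of[of 1 "zip U' L'"]
      by (auto simp: words_def polyo_word_def paths_to_def numeral_eq_Suc)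
  qed
  moreover have "v \<in> polyo_word ` Polyo n m" if v: "v \<in> words n (m - 1)" for v
  proof -
    obtain w where w: "v = 1 # w" "capped (2 * 1) w"
      using v \<open>0 < n\<close> by (cases v) (auto simp: words_def numeral_eq_Suc)
    then obtain ps where ps: "excursion 1 ps" "word_of 1 ps = w"
      using word_of_surj by blast
    let ?U = "North # map fst ps" and ?L = "East # map snd ps"
    have "count_list ?L East = n" "count_list ?U North = m"
      using v w ps odd_word_of[OF ps(1)] even_word_of[OF ps(1)] \<open>0 < m\<close>
      by (auto simp: words_def)
    \<comment> \<open>The word fixes only the lower East and the upper North steps; the upper East
      steps are counted through the return to distance 0.\<close>
    moreover have "count_list ?U East = count_list ?L East"
      using ps(1) unfolding excursion_iff by simp
    ultimately have "?U \<in> paths_to n m" "?L \<in> paths_to n m"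
      using count_list_steps[of ?U] count_list_steps[of ?L] by (simp_all add: paths_to_def)
    then have "(?U, ?L) \<in> Polyo n m"
      unfolding Polyo_iff using ps by (simp add: zip_map_fst_snd)
    moreover have "polyo_word (?U, ?L) = v"
      using w ps by (simp add: polyo_word_def zip_map_fst_snd)
    ultimately show ?thesis
      by (metis imageI)
  qed
  ultimately show "polyo_word ` Polyo n m = words n (m - 1)"
    by auto
qed

lemma Nara_eq_word_gf:
  assumes "0 < n" "0 < m"
  shows "Nara r s n m = word_gf r s n (m - 1)"
proof -
  have count: "count_list (area_word P) (Plain 1) = count_list (polyo_word P) 1"
    "count_list (area_word P) (Bar 1) = count_list (polyo_word P) 2" if "P \<in> Polyo n m" for P
  proof -
    have "count_list (area_word P) (letter_of x) = count_list (0 # polyo_word P) x" for x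
      unfolding area_word_eq[OF that] by (rule count_list_map_conv) (rule inj_letter_of)
    from this[of 1] this[of 2]
    show "count_list (area_word P) (Plain 1) = count_list (polyo_word P) 1"
      "count_list (area_word P) (Bar 1) = count_list (polyo_word P) 2"
      by (simp_all add: letter_of_def)
  qed
  let ?in_rs = "\<lambda>v. count_list v 1 = r \<and> count_list v 2 = s"
  have "Polyo_rs r s n m = {P \<in> Polyo n m. ?in_rs (polyo_word P)}"
    unfolding Polyo_rs_def by (intro Collect_cong conj_cong refl) (simp_all only: count)
  moreover have "polyo_word ` {P \<in> Polyo n m. ?in_rs (polyo_word P)} = words_rs r s n (m - 1)"
    unfolding words_rs_def bij_betw_imp_surj_on[OF polyo_word_bij_betw[OF assms], symmetric]
    by blast
  ultimately have "bij_betw polyo_word (Polyo_rs r s n m) (words_rs r s n (m - 1))"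
    by (intro bij_betw_subset[OF polyo_word_bij_betw[OF assms]]) auto
  then have "word_gf r s n (m - 1) = (\<Sum>P\<in>Polyo_rs r s n m. word_weight (polyo_word P))"
    unfolding word_gf_def by (rule sum.reindex_bij_betw[symmetric])
  also have "\<dots> = Nara r s n m"
    unfolding Nara_def
    by (intro sum.cong refl) (simp add: Polyo_rs_def word_weight_def area_eq[of _ n m] dinv_eq[of _ n m])
  finally show ?thesis ..
qed

theorem theorem5p2:
  fixes m n :: nat
  assumes "1 \<le> m" and "1 \<le> n"
  shows "(\<forall>r s. 1 \<le> r \<and> r \<le> n - 1 \<and> s \<le> m - 1 \<longrightarrow>
            Nara r s n m =
              t_var ^ (m + n - 1) * q_var ^ r *
              (\<Sum>h = 1..n - r. \<Sum>k = 0..m - s - 1.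
                 q_var ^ s * q_binom q_var (s + r - 1) s * q_binom q_var (s + h - 1) h *
                 Nara h k (n - r) (m - s)))
       \<and> (\<forall>s. s \<le> m - 1 \<longrightarrow>
            Nara n s n m =
              (if s = m - 1
               then (q_var * t_var) ^ (m + n - 1) * q_binom q_var (m + n - 2) (m - 1)
               else 0))
       \<and> (\<forall>r. 1 \<le> r \<and> r < n \<longrightarrow> Nara r 0 n 1 = 0)"
proof (intro conjI allI impI)
  fix r s
  assume rs: "1 \<le> r \<and> r \<le> n - 1 \<and> s \<le> m - 1"
  then have "r < n" "s < m"
    using assms by linarith+
  then have "Nara h k (n - r) (m - s) = word_gf h k (n - r) (m - 1 - s)" for h k
    using Nara_eq_word_gf[of "n - r" "m - s" h k] by (simp add: diff_commute)
  moreover have "n + (m - 1) = m + n - 1" "m - s - 1 = m - 1 - s"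
    using assms by simp_all
  ultimately show "Nara r s n m =
      t_var ^ (m + n - 1) * q_var ^ r *
      (\<Sum>h = 1..n - r. \<Sum>k = 0..m - s - 1.
         q_var ^ s * q_binom q_var (s + r - 1) s * q_binom q_var (s + h - 1) h *
         Nara h k (n - r) (m - s))"
    using word_gf_recursion[of r n s "m - 1"] Nara_eq_word_gf[of n m r s] rs assms \<open>r < n\<close>
    by simp
next
  fix s
  assume "s \<le> m - 1"
  have "n + (m - 1) = m + n - 1" "m - 1 + n - 1 = m + n - 2"
    using assms by simp_all
  then show "Nara n s n m =
      (if s = m - 1
       then (q_var * t_var) ^ (m + n - 1) * q_binom q_var (m + n - 2) (m - 1)
       else 0)"
    using word_gf_full[of n s "m - 1"] Nara_eq_word_gf[of n m n s] assms by simp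
next
  fix r
  assume r: "1 \<le> r \<and> r < n"
  \<comment> \<open>For \<open>s = 0\<close> this is the second binomial of every term in the
    recursion.\<close>
  have "q_binom q_var (h - 1) h = 0" if "1 \<le> h" for h
    using that by (auto simp: q_binom_def)
  then have "word_gf r 0 n 0 = 0"
    using word_gf_recursion[of r n 0 0] r by (auto intro!: sum.neutral)
  then show "Nara r 0 n 1 = 0"
    using Nara_eq_word_gf[of n 1 r 0] r by simp
qed

end
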